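(* In the missing-at-random setting of the context with $0<p_{A|X}(x)<1$ for all $x\in\mathcal X$ and $\varepsilon>0$, define (when $N^{(0)}\ge1$) for all $x\in\mathcal X$ $$\hat C^{\mathrm{pro}2}(x)=\Big\{y: s(x,y)\le Q_{1-\alpha^2}\Big(\sum_{k=1}^M\sum_{i\in I_k^{\mathcal B}}\frac{N_k^{\mathcal B,0}}{(N^{(0)})^2N_k^{\mathcal B}}\delta_{\bar S_i}+\sum_{k=1}^M\sum_{\substack{i,j\in I_k^{\mathcal B}\\ i\ne j}}\frac{N_k^{\mathcal B,0}(N_k^{\mathcal B,0}-1)}{(N^{(0)})^2N_k^{\mathcal B}(N_k^{\mathcal B}-1)}\delta_{\min\{\bar S_i,\bar S_j\}}+\sum_{1\le k\ne k'\le M}\sum_{i\in I_k^{\mathcal B}}\sum_{j\in I_{k'}^{\mathcal B}}\frac{N_k^{\mathcal B,0}N_{k'}^{\mathcal B,0}}{(N^{(0)})^2N_k^{\mathcal B}N_{k'}^{\mathcal B}}\delta_{\min\{\bar S_i,\bar S_j\}}\Big)\Big\}$$ (middle coefficient $:=0$ if $N_k^{\mathcal B}=1$). Then $$\mathbb E\Big[\Big(\frac{1}{N^{(0)}}\sum_{i\in I_{A=0}}\mathbf 1\{Y_i\notin\hat C^{\mathrm{pro}2}(X_i)\}\Big)^2\ \Big|\ B_{1:n},A_{1:n}\Big]\le\alpha^2+2\varepsilon.$$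
   Context: Missing-at-random setting: $(X_i,Y_i,A_i)_{1\le i\le n}$ i.i.d. with $X\sim P_X$, $Y\mid X\sim P_{Y|X}$, $A\mid X\sim\mathrm{Bernoulli}(p_{A|X}(X))$, $A\perp Y\mid X$; observed data $(X_i,A_i,Y_iA_i)$; $p_{A|X}(x)=\mathbb P(A=1|X=x)$. $I_{A=0}=\{i:A_i=0\}$, $N^{(0)}=|I_{A=0}|$. $s$ is a fixed measurable score (independent of the data), $S_i=s(X_i,Y_i)$, $\bar S_i=S_i$ if $A_i=1$ and $\bar S_i=+\infty$ if $A_i=0$. Discretization: $z_k=(1+\varepsilon)^k/(1+(1+\varepsilon)^k)$, $D_k=\{x:p_{A|X}(x)\in[z_k,z_{k+1})\}$, $k\in\mathbb Z$; $B_i$ = the $k$ with $X_i\in D_k$. $B'_1,\dots,B'_M$ are the distinct values of $B_{1:n}$, $I_k^{\mathcal B}=\{i:B_i=B'_k\}$, $I_k^{\mathcal B,0}=\{i\in I_k^{\mathcal B}:A_i=0\}$, $N_k^{\mathcal B}=|I_k^{\mathcal B}|$, $N_k^{\mathcal B,0}=|I_k^{\mathcal B,0}|$. $Q_{1-\beta}(P)=\inf\{t:\mathbb P_{T\sim P}(T\le t)\ge1-\beta\}$; $\delta_v$ is a point mass. Miscoverage proportion is $0$ when $N^{(0)}=0$. *)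

theory Defs
  imports "HOL-Probability.Probability"
begin

definition zgrid :: "real \<Rightarrow> int \<Rightarrow> real" where
  "zgrid \<epsilon> k = (1 + \<epsilon>) powr (real_of_int k) / (1 + (1 + \<epsilon>) powr (real_of_int k))"

definition bin :: "real \<Rightarrow> real \<Rightarrow> int" where
  "bin \<epsilon> q = (THE k. zgrid \<epsilon> k \<le> q \<and> q < zgrid \<epsilon> (k + 1))"

text \<open>Quantile Q_gamma(P) = inf {t. P(T \<le> t) \<ge> gamma}, P given through its cdf F.\<close>
definition Qlevel :: "real \<Rightarrow> (ereal \<Rightarrow> real) \<Rightarrow> ereal" where
  "Qlevel \<gamma> F = Inf {t. \<gamma> \<le> F t}"

definition Nall :: "nat \<Rightarrow> (nat \<Rightarrow> int) \<Rightarrow> int \<Rightarrow> real" where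
  "Nall n Bv b = real (card {i\<in>{..<n}. Bv i = b})"
definition Nzero :: "nat \<Rightarrow> (nat \<Rightarrow> int) \<Rightarrow> (nat \<Rightarrow> bool) \<Rightarrow> int \<Rightarrow> real" where
  "Nzero n Bv Av b = real (card {i\<in>{..<n}. Bv i = b \<and> \<not> Av i})"
definition N0 :: "nat \<Rightarrow> (nat \<Rightarrow> bool) \<Rightarrow> real" where
  "N0 n Av = real (card {i\<in>{..<n}. \<not> Av i})"

text \<open>cdf t \<mapsto> P(T \<le> t) of the weighted sum of point masses in the definition of C^pro2,
  with Sb the (extended) scores S-bar. Sums over k and i in I_k are flattened into sums over i.\<close>
definition pro2_cdf :: "nat \<Rightarrow> (nat \<Rightarrow> int) \<Rightarrow> (nat \<Rightarrow> bool) \<Rightarrow> (nat \<Rightarrow> ereal) \<Rightarrow> ereal \<Rightarrow> real" where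
  "pro2_cdf n Bv Av Sb t =
     (\<Sum>i<n. Nzero n Bv Av (Bv i) / ((N0 n Av)\<^sup>2 * Nall n Bv (Bv i))
              * (if Sb i \<le> t then 1 else 0))
   + (\<Sum>i<n. \<Sum>j\<in>{j\<in>{..<n}. j \<noteq> i \<and> Bv j = Bv i}.
        (if Nall n Bv (Bv i) = 1 then 0 else
          Nzero n Bv Av (Bv i) * (Nzero n Bv Av (Bv i) - 1)
          / ((N0 n Av)\<^sup>2 * Nall n Bv (Bv i) * (Nall n Bv (Bv i) - 1)))
        * (if min (Sb i) (Sb j) \<le> t then 1 else 0))
   + (\<Sum>i<n. \<Sum>j\<in>{j\<in>{..<n}. Bv j \<noteq> Bv i}.
        Nzero n Bv Av (Bv i) * Nzero n Bv Av (Bv j)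
        / ((N0 n Av)\<^sup>2 * Nall n Bv (Bv i) * Nall n Bv (Bv j))
        * (if min (Sb i) (Sb j) \<le> t then 1 else 0))"

text \<open>Sample: \<omega> i = (X_i, Y_i, A_i).\<close>
definition Sbar :: "('x \<Rightarrow> 'y \<Rightarrow> real) \<Rightarrow> (nat \<Rightarrow> 'x \<times> 'y \<times> bool) \<Rightarrow> nat \<Rightarrow> ereal" where
  "Sbar s \<omega> i = (if snd (snd (\<omega> i)) then ereal (s (fst (\<omega> i)) (fst (snd (\<omega> i)))) else \<infinity>)"

definition Bvec :: "real \<Rightarrow> ('x \<Rightarrow> real) \<Rightarrow> (nat \<Rightarrow> 'x \<times> 'y \<times> bool) \<Rightarrow> nat \<Rightarrow> int" where
  "Bvec \<epsilon> p \<omega> i = bin \<epsilon> (p (fst (\<omega> i)))"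

definition Avec :: "(nat \<Rightarrow> 'x \<times> 'y \<times> bool) \<Rightarrow> nat \<Rightarrow> bool" where
  "Avec \<omega> i = snd (snd (\<omega> i))"

definition Qpro2 :: "nat \<Rightarrow> real \<Rightarrow> real \<Rightarrow> ('x \<Rightarrow> real) \<Rightarrow> ('x \<Rightarrow> 'y \<Rightarrow> real)
    \<Rightarrow> (nat \<Rightarrow> 'x \<times> 'y \<times> bool) \<Rightarrow> ereal" where
  "Qpro2 n \<alpha> \<epsilon> p s \<omega> = Qlevel (1 - \<alpha>\<^sup>2) (pro2_cdf n (Bvec \<epsilon> p \<omega>) (Avec \<omega>) (Sbar s \<omega>))"

definition Cpro2 :: "nat \<Rightarrow> real \<Rightarrow> real \<Rightarrow> ('x \<Rightarrow> real) \<Rightarrow> ('x \<Rightarrow> 'y \<Rightarrow> real)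
    \<Rightarrow> (nat \<Rightarrow> 'x \<times> 'y \<times> bool) \<Rightarrow> 'x \<Rightarrow> 'y set" where
  "Cpro2 n \<alpha> \<epsilon> p s \<omega> x = {y. ereal (s x y) \<le> Qpro2 n \<alpha> \<epsilon> p s \<omega>}"

definition miscov :: "nat \<Rightarrow> real \<Rightarrow> real \<Rightarrow> ('x \<Rightarrow> real) \<Rightarrow> ('x \<Rightarrow> 'y \<Rightarrow> real)
    \<Rightarrow> (nat \<Rightarrow> 'x \<times> 'y \<times> bool) \<Rightarrow> real" where
  "miscov n \<alpha> \<epsilon> p s \<omega> =
    (if N0 n (Avec \<omega>) = 0 then 0 else
      (1 / N0 n (Avec \<omega>)) * (\<Sum>i\<in>{i\<in>{..<n}. \<not> Avec \<omega> i}.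
         (if fst (snd (\<omega> i)) \<notin> Cpro2 n \<alpha> \<epsilon> p s \<omega> (fst (\<omega> i)) then 1 else 0)))"

text \<open>Law of one observation (X, Y, A): X ~ PX, Y|X ~ K X, A|X ~ Bernoulli(p X), A indep Y given X.\<close>
definition obs_law :: "'x measure \<Rightarrow> 'y measure \<Rightarrow> ('x \<Rightarrow> 'y measure) \<Rightarrow> ('x \<Rightarrow> real)
    \<Rightarrow> ('x \<times> 'y \<times> bool) measure" where
  "obs_law PX MY K p = PX \<bind> (\<lambda>x. K x \<bind> (\<lambda>y. measure_pmf (bernoulli_pmf (p x)) \<bind>
       (\<lambda>a. return (PX \<Otimes>\<^sub>M MY \<Otimes>\<^sub>M count_space UNIV) (x, y, a))))"

definition BA_algebra :: "nat \<Rightarrow> real \<Rightarrow> ('x \<Rightarrow> real) \<Rightarrow> (nat \<Rightarrow> 'x \<times> 'y \<times> bool) measure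
    \<Rightarrow> (nat \<Rightarrow> 'x \<times> 'y \<times> bool) measure" where
  "BA_algebra n \<epsilon> p M = vimage_algebra (space M)
      (\<lambda>\<omega>. \<lambda>i\<in>{..<n}. (Bvec \<epsilon> p \<omega> i, Avec \<omega> i)) (count_space UNIV)"

end

theory Submission
  imports Defs
begin

text \<open>
  Replacing the masked scores by the true ones only lowers the quantile, so it suffices to bound
  exceedances of the quantile of all scores, which is symmetric under permutations within a bin.
  Integrating out the missingness indicators leaves an i.i.d. law for the pairs \<open>(X, Y)\<close>, weighted by
  \<open>p X\<close> or \<open>1 - p X\<close> according to \<open>A\<close>. Exchanging two pairs in one bin changes the weight by a
  factor of at most the ratio of their odds, hence at most \<open>1 + \<epsilon>\<close>. Two exchanges carry any
  pair of indices to any other pair of the same type (same bins, both equal or both distinct), so the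
  probability of a joint exceedance given the bins and \<open>A\<close> is at most \<open>(1 + \<epsilon>)\<^sup>2\<close> times its
  average over the type. These averages are what the weights of the quantile's distribution compute,
  which gives the bound \<open>min 1 ((1 + \<epsilon>)\<^sup>2 * \<alpha>\<^sup>2)\<close>, and this is at most \<open>\<alpha>\<^sup>2 + 2 * \<epsilon>\<close>.
\<close>

subsection \<open>The propensity grid\<close>

text \<open>The grid is geometric on the odds scale: \<open>zgrid \<epsilon> m\<close> is the
  probability with odds \<open>(1 + \<epsilon>) powr m\<close>. So the cell of \<open>q\<close> is
  the integer part of its log-odds to base \<open>1 + \<epsilon>\<close>, which gives existence and
  uniqueness for the \<open>THE\<close> in \<open>bin\<close>.\<close>

lemma zgrid_between_iff:
  assumes "0 < \<epsilon>" "0 < q" "q < 1"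
  shows "zgrid \<epsilon> k \<le> q \<and> q < zgrid \<epsilon> (k + 1) \<longleftrightarrow> k = \<lfloor>log (1 + \<epsilon>) (q / (1 - q))\<rfloor>"
proof -
  have le: "zgrid \<epsilon> m \<le> q \<longleftrightarrow> real_of_int m \<le> log (1 + \<epsilon>) (q / (1 - q))" for m
  proof -
    define w where "w = (1 + \<epsilon>) powr real_of_int m"
    have "w > 0" unfolding w_def using assms by simp
    have "zgrid \<epsilon> m \<le> q \<longleftrightarrow> w \<le> q * (1 + w)"
      unfolding zgrid_def w_def[symmetric] using \<open>w > 0\<close> by (simp add: pos_divide_le_eq)
    also have "\<dots> \<longleftrightarrow> w \<le> q / (1 - q)"
      using assms by (simp add: pos_le_divide_eq algebra_simps)
    also have "\<dots> \<longleftrightarrow> real_of_int m \<le> log (1 + \<epsilon>) (q / (1 - q))"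
      unfolding w_def using assms by (subst le_log_iff) auto
    finally show ?thesis .
  qed
  have "q < zgrid \<epsilon> (k + 1) \<longleftrightarrow> log (1 + \<epsilon>) (q / (1 - q)) < real_of_int k + 1"
    using le[of "k + 1"] by auto
  with le[of k] show ?thesis by (simp add: eq_commute[of k] floor_eq_iff)
qed

lemma bin_eq_floor:
  assumes "0 < \<epsilon>" "0 < q" "q < 1"
  shows "bin \<epsilon> q = \<lfloor>log (1 + \<epsilon>) (q / (1 - q))\<rfloor>"
  unfolding bin_def using zgrid_between_iff[OF assms] by simp

text \<open>Logarithms with the same floor differ by less than 1, so odds within a bin differ by a
  factor of at most \<open>1 + \<epsilon>\<close>. The cross-multiplied form is the one met when two
  units with opposite arms exchange their covariates.\<close>

lemma bin_eq_odds_le: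
  assumes "0 < \<epsilon>" "0 < q" "q < 1" "0 < r" "r < 1" "bin \<epsilon> q = bin \<epsilon> r"
  shows "q * (1 - r) \<le> (1 + \<epsilon>) * (r * (1 - q))"
proof -
  define a where "a = log (1 + \<epsilon>) (q / (1 - q))"
  define b where "b = log (1 + \<epsilon>) (r / (1 - r))"
  have "\<lfloor>a\<rfloor> = \<lfloor>b\<rfloor>" using assms by (simp add: bin_eq_floor a_def b_def)
  then have "a \<le> 1 + b" by linarith
  moreover have q: "q / (1 - q) = (1 + \<epsilon>) powr a" and r: "r / (1 - r) = (1 + \<epsilon>) powr b"
    unfolding a_def b_def using assms by (simp_all add: powr_log_cancel)
  ultimately have "q / (1 - q) \<le> (1 + \<epsilon>) powr (1 + b)"
    using assms by (simp add: powr_mono)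
  also have "\<dots> = (1 + \<epsilon>) * (r / (1 - r))"
    using assms by (simp add: powr_add r)
  finally show ?thesis using assms by (simp add: field_simps)
qed

subsection \<open>Averaging over types of index pairs\<close>

text \<open>Double counting: each \<open>z\<close> in \<open>P0\<close> spreads unit mass evenly
  over its class in \<open>P\<close>, and the left side collects the mass that arrives at each
  \<open>x\<close>.\<close>

lemma sum_class_average:
  fixes E :: "'a \<Rightarrow> real"
  assumes "finite P" "P0 \<subseteq> P"
  shows "(\<Sum>x\<in>P. real (card {z\<in>P0. \<tau> z = \<tau> x}) / real (card {z\<in>P. \<tau> z = \<tau> x}) * E x)
       = (\<Sum>z\<in>P0. (\<Sum>x | x \<in> P \<and> \<tau> x = \<tau> z. E x) / real (card {x\<in>P. \<tau> x = \<tau> z}))"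
proof -
  have fin: "finite P0" using assms finite_subset by blast
  have "(\<Sum>x\<in>P. real (card {z\<in>P0. \<tau> z = \<tau> x}) / real (card {z\<in>P. \<tau> z = \<tau> x}) * E x)
      = (\<Sum>x\<in>P. \<Sum>z | z \<in> P0 \<and> \<tau> x = \<tau> z. E x / real (card {x\<in>P. \<tau> x = \<tau> z}))"
  proof (rule sum.cong[OF refl])
    fix x assume "x \<in> P"
    have "(\<Sum>z | z \<in> P0 \<and> \<tau> x = \<tau> z. E x / real (card {x\<in>P. \<tau> x = \<tau> z}))
        = (\<Sum>z | z \<in> P0 \<and> \<tau> x = \<tau> z. E x / real (card {y\<in>P. \<tau> y = \<tau> x}))"
      by (rule sum.cong) auto
    then show "real (card {z\<in>P0. \<tau> z = \<tau> x}) / real (card {z\<in>P. \<tau> z = \<tau> x}) * E x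
        = (\<Sum>z | z \<in> P0 \<and> \<tau> x = \<tau> z. E x / real (card {x\<in>P. \<tau> x = \<tau> z}))"
      by (simp add: eq_commute[of "\<tau> x"])
  qed
  also have "\<dots> = (\<Sum>z\<in>P0. \<Sum>x | x \<in> P \<and> \<tau> x = \<tau> z. E x / real (card {x\<in>P. \<tau> x = \<tau> z}))"
    by (rule sum.swap_restrict[OF assms(1) fin])
  finally show ?thesis by (simp add: sum_divide_distrib)
qed

text \<open>A value that is at most \<open>c\<close> times every value in its class is at most
  \<open>c\<close> times the class mean. The intended \<open>P0\<close> is the set of pairs of
  missing indices, \<open>P\<close> all pairs, and \<open>\<tau>\<close> the type of a pair.\<close>

lemma sum_le_class_average:
  fixes E :: "'a \<Rightarrow> real"
  assumes "finite P" "P0 \<subseteq> P"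
    and "\<And>z x. z \<in> P0 \<Longrightarrow> x \<in> P \<Longrightarrow> \<tau> x = \<tau> z \<Longrightarrow> E z \<le> c * E x"
  shows "(\<Sum>z\<in>P0. E z)
       \<le> c * (\<Sum>x\<in>P. real (card {z\<in>P0. \<tau> z = \<tau> x}) / real (card {z\<in>P. \<tau> z = \<tau> x}) * E x)"
proof -
  have "E z \<le> c * ((\<Sum>x | x \<in> P \<and> \<tau> x = \<tau> z. E x) / real (card {x\<in>P. \<tau> x = \<tau> z}))"
    if "z \<in> P0" for z
  proof -
    let ?C = "{x\<in>P. \<tau> x = \<tau> z}"
    have "z \<in> ?C" "finite ?C" using that assms by auto
    then have pos: "0 < card ?C" by (metis card_gt_0_iff empty_iff)
    have "real (card ?C) * E z \<le> (\<Sum>x\<in>?C. c * E x)"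
      using sum_mono[of ?C "\<lambda>_. E z" "\<lambda>x. c * E x"] assms(3)[OF that] by simp
    then show ?thesis using pos by (simp add: field_simps sum_distrib_left)
  qed
  then have "(\<Sum>z\<in>P0. E z)
      \<le> (\<Sum>z\<in>P0. c * ((\<Sum>x | x \<in> P \<and> \<tau> x = \<tau> z. E x) / real (card {x\<in>P. \<tau> x = \<tau> z})))"
    by (rule sum_mono)
  then show ?thesis
    by (simp only: sum_class_average[OF assms(1,2)] sum_distrib_left)
qed

text \<open>The last component separates the diagonal: no permutation of indices carries a pair
  \<open>(i, i)\<close> to a pair of distinct indices.\<close>

definition pair_key :: "(nat \<Rightarrow> int) \<Rightarrow> nat \<times> nat \<Rightarrow> int \<times> int \<times> bool" where
  "pair_key b = (\<lambda>(i, j). (b i, b j, i = j))"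

lemma card_pair_key:
  assumes "finite I"
  shows "real (card {z \<in> I \<times> I. pair_key b z = (k, l, e)}) =
    (if e then if k = l then real (card {i\<in>I. b i = k}) else 0
     else if k = l then real (card {i\<in>I. b i = k}) * (real (card {i\<in>I. b i = k}) - 1)
     else real (card {i\<in>I. b i = k}) * real (card {i\<in>I. b i = l}))"
proof -
  let ?A = "\<lambda>k. {i\<in>I. b i = k}"
  have fin: "finite (?A k)" for k using assms by simp
  have diag: "card ((\<lambda>i. (i, i)) ` ?A k) = card (?A k)"
    by (rule card_image) (simp add: inj_on_def)
  consider "e" "k = l" | "e" "k \<noteq> l" | "\<not> e" "k = l" | "\<not> e" "k \<noteq> l" by blast
  then show ?thesis
  proof cases
    case 1
    then have "{z \<in> I \<times> I. pair_key b z = (k, l, e)} = (\<lambda>i. (i, i)) ` ?A k"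
      by (auto simp: pair_key_def)
    then show ?thesis using 1 diag by simp
  next
    case 2
    then have "{z \<in> I \<times> I. pair_key b z = (k, l, e)} = {}" by (auto simp: pair_key_def)
    then show ?thesis using 2 by (simp only: card.empty) simp
  next
    case 3
    then have eq: "{z \<in> I \<times> I. pair_key b z = (k, l, e)} = ?A k \<times> ?A k - (\<lambda>i. (i, i)) ` ?A k"
      by (auto simp: pair_key_def)
    have "card (?A k \<times> ?A k - (\<lambda>i. (i, i)) ` ?A k) = card (?A k) * card (?A k) - card (?A k)"
      using fin diag by (subst card_Diff_subset) (auto simp: card_cartesian_product)
    also have "real \<dots> = real (card (?A k)) * (real (card (?A k)) - 1)"
      by (simp add: of_nat_diff algebra_simps)
    finally show ?thesis using 3 eq by simp
  next
    case 4
    then have "{z \<in> I \<times> I. pair_key b z = (k, l, e)} = ?A k \<times> ?A l"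
      by (auto simp: pair_key_def)
    then show ?thesis using 4 by (simp add: card_cartesian_product)
  qed
qed

text \<open>One formula for all three coefficients of the procedure: the share of missing pairs
  among all pairs of the same type, normalised by the number of missing pairs.\<close>

definition pro2_weight :: "nat \<Rightarrow> (nat \<Rightarrow> int) \<Rightarrow> (nat \<Rightarrow> bool) \<Rightarrow> nat \<times> nat \<Rightarrow> real" where
  "pro2_weight n b a z =
     real (card {w \<in> {i\<in>{..<n}. \<not> a i} \<times> {i\<in>{..<n}. \<not> a i}. pair_key b w = pair_key b z})
     / real (card {w \<in> {..<n} \<times> {..<n}. pair_key b w = pair_key b z}) / (N0 n a)\<^sup>2"

lemma pro2_weight_nonneg: "0 \<le> pro2_weight n b a z"
  by (simp add: pro2_weight_def)

text \<open>The counts of \<open>card_pair_key\<close> turn the ratio into the three coefficients.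
  The convention 0 for a bin of size one agrees with division by zero, since the denominator
  contains \<open>Nall - 1\<close>.\<close>

lemma pro2_weight_eq:
  assumes "i < n" "j < n"
  shows "pro2_weight n b a (i, j) =
    (if i = j then Nzero n b a (b i) / ((N0 n a)\<^sup>2 * Nall n b (b i))
     else if b i = b j then
       (if Nall n b (b i) = 1 then 0 else
          Nzero n b a (b i) * (Nzero n b a (b i) - 1)
          / ((N0 n a)\<^sup>2 * Nall n b (b i) * (Nall n b (b i) - 1)))
     else Nzero n b a (b i) * Nzero n b a (b j)
        / ((N0 n a)\<^sup>2 * Nall n b (b i) * Nall n b (b j)))"
proof -
  have key: "pair_key b (i, j) = (b i, b j, i = j)" by (simp add: pair_key_def)
  have "{k \<in> {k\<in>{..<n}. \<not> a k}. b k = c} = {k\<in>{..<n}. b k = c \<and> \<not> a k}" for c by auto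
  then have zero: "real (card {k \<in> {k\<in>{..<n}. \<not> a k}. b k = c}) = Nzero n b a c" for c
    by (simp only: Nzero_def)
  have all: "real (card {k\<in>{..<n}. b k = c}) = Nall n b c" for c
    by (simp only: Nall_def)
  have fin: "finite {k\<in>{..<n}. \<not> a k}" "finite {..<n}" by simp_all
  show ?thesis
    unfolding pro2_weight_def key card_pair_key[OF fin(1)] card_pair_key[OF fin(2)] zero all
    by (simp add: mult_ac)
qed

text \<open>On the diagonal the minimum of the two scores is the score itself, so the single-index
  sum is the diagonal part of one sum over all ordered pairs; the other two sums split the rest by
  equal or distinct bins.\<close>

lemma pro2_cdf_eq_weight:
  "pro2_cdf n b a S t =
     (\<Sum>z\<in>{..<n} \<times> {..<n}. pro2_weight n b a z * (if min (S (fst z)) (S (snd z)) \<le> t then 1 else 0))"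
proof -
  let ?g = "\<lambda>i j. pro2_weight n b a (i, j) * (if min (S i) (S j) \<le> t then 1 else 0)"
  have inner: "(\<Sum>j<n. ?g i j) = ?g i i + (\<Sum>j\<in>{j\<in>{..<n}. j \<noteq> i \<and> b j = b i}. ?g i j)
      + (\<Sum>j\<in>{j\<in>{..<n}. b j \<noteq> b i}. ?g i j)" if "i < n" for i
  proof -
    have "{..<n} = {i} \<union> {j\<in>{..<n}. j \<noteq> i \<and> b j = b i} \<union> {j\<in>{..<n}. b j \<noteq> b i}"
      using that by auto
    then have "sum (?g i) {..<n}
        = sum (?g i) ({i} \<union> {j\<in>{..<n}. j \<noteq> i \<and> b j = b i} \<union> {j\<in>{..<n}. b j \<noteq> b i})"
      by (rule arg_cong)
    also have "\<dots> = ?g i i + (\<Sum>j\<in>{j\<in>{..<n}. j \<noteq> i \<and> b j = b i}. ?g i j)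
        + (\<Sum>j\<in>{j\<in>{..<n}. b j \<noteq> b i}. ?g i j)"
    proof -
      have "{i} \<inter> {j\<in>{..<n}. j \<noteq> i \<and> b j = b i} = {}"
        "({i} \<union> {j\<in>{..<n}. j \<noteq> i \<and> b j = b i}) \<inter> {j\<in>{..<n}. b j \<noteq> b i} = {}"
        by auto
      then show ?thesis by (simp add: sum.union_disjoint del: Un_insert_left)
    qed
    finally show ?thesis .
  qed
  have "(\<Sum>z\<in>{..<n} \<times> {..<n}. pro2_weight n b a z * (if min (S (fst z)) (S (snd z)) \<le> t then 1 else 0))
      = (\<Sum>i<n. \<Sum>j<n. ?g i j)"
    by (simp add: sum.cartesian_product split_beta)
  also have "\<dots> = (\<Sum>i<n. ?g i i + (\<Sum>j\<in>{j\<in>{..<n}. j \<noteq> i \<and> b j = b i}. ?g i j)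
      + (\<Sum>j\<in>{j\<in>{..<n}. b j \<noteq> b i}. ?g i j))"
    by (rule sum.cong[OF refl], rule inner) simp
  also have "\<dots> = pro2_cdf n b a S t"
    unfolding pro2_cdf_def sum.distrib
    by (intro arg_cong2[of _ _ _ _ "(+)"]; (rule sum.cong[OF refl])+; force simp: pro2_weight_eq)
  finally show ?thesis by simp
qed

text \<open>Class averaging applied to the constant 1: every class mean is 1, so the unnormalised
  weights add up to the number of missing pairs.\<close>

lemma sum_pro2_weight:
  assumes "N0 n a \<noteq> 0"
  shows "(\<Sum>z\<in>{..<n} \<times> {..<n}. pro2_weight n b a z) = 1"
proof -
  let ?I = "{i\<in>{..<n}. \<not> a i}" and ?P = "{..<n} \<times> {..<n}"
  have "(\<Sum>z\<in>?P. real (card {w\<in>?I \<times> ?I. pair_key b w = pair_key b z})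
        / real (card {w\<in>?P. pair_key b w = pair_key b z}) * 1)
      = (\<Sum>z\<in>?I \<times> ?I. (\<Sum>x | x \<in> ?P \<and> pair_key b x = pair_key b z. 1)
          / real (card {x\<in>?P. pair_key b x = pair_key b z}))"
    by (rule sum_class_average) auto
  also have "\<dots> = (\<Sum>z\<in>?I \<times> ?I. 1)"
  proof (rule sum.cong[OF refl])
    fix z assume z: "z \<in> ?I \<times> ?I"
    have "finite {x\<in>?P. pair_key b x = pair_key b z}" by simp
    moreover have "{x\<in>?P. pair_key b x = pair_key b z} \<noteq> {}" using z by blast
    ultimately have "card {x\<in>?P. pair_key b x = pair_key b z} \<noteq> 0" by simp
    then show "(\<Sum>x | x \<in> ?P \<and> pair_key b x = pair_key b z. 1)
        / real (card {x\<in>?P. pair_key b x = pair_key b z}) = 1" by simp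
  qed
  also have "\<dots> = (N0 n a)\<^sup>2"
    by (simp add: card_cartesian_product N0_def power2_eq_square)
  finally show ?thesis
    unfolding pro2_weight_def sum_divide_distrib[symmetric] using assms by simp
qed

subsection \<open>Quantiles of weighted point masses\<close>

text \<open>The infimum in the quantile is attained because \<open>F\<close> is a step function that
  is constant from any point up to the next atom on its right.\<close>

lemma weighted_cdf_Qlevel:
  fixes T :: "'a \<Rightarrow> ereal" and c :: "'a \<Rightarrow> real"
  assumes "finite L" "\<gamma> \<le> (\<Sum>l\<in>L. c l)"
  defines "F \<equiv> \<lambda>t. \<Sum>l\<in>L. c l * (if T l \<le> t then 1 else 0)"
  shows "\<gamma> \<le> F (Qlevel \<gamma> F)"
proof -
  let ?m = "Qlevel \<gamma> F" and ?U = "{u \<in> T ` L. Qlevel \<gamma> F < u}"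
  have fin: "finite ?U" using assms by simp
  have "\<gamma> \<le> F \<infinity>" using assms(2) by (simp add: F_def)
  \<comment> \<open>A level that reaches \<open>\<gamma>\<close> and lies below all atoms above the
    infimum. If there are no such atoms, \<open>\<infinity>\<close> serves; otherwise the infimum is
    less than the smallest of them, and some admissible level lies below it.\<close>
  have "\<exists>t. ?m \<le> t \<and> \<gamma> \<le> F t \<and> (\<forall>u\<in>?U. t < u)"
  proof (cases "?U = {}")
    case True
    then show ?thesis using \<open>\<gamma> \<le> F \<infinity>\<close> by (intro exI[of _ \<infinity>]) auto
  next
    case False
    then have "?m < Min ?U" using fin by simp
    then obtain t where "\<gamma> \<le> F t" "t < Min ?U"
      unfolding Qlevel_def Inf_less_iff by blast
    moreover from \<open>\<gamma> \<le> F t\<close> have "?m \<le> t" unfolding Qlevel_def by (simp add: Inf_lower)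
    ultimately show ?thesis using fin False by auto
  qed
  then obtain t where t: "?m \<le> t" "\<gamma> \<le> F t" "\<forall>u\<in>?U. t < u" by blast
  have F: "F x = (\<Sum>l\<in>L. c l * (if T l \<le> x then 1 else 0))" for x
    by (simp add: F_def)
  have "F t = F ?m"
    unfolding F[of t] F[of ?m]
  proof (rule sum.cong[OF refl])
    fix l assume "l \<in> L"
    have "T l \<le> t \<longleftrightarrow> T l \<le> ?m"
    proof
      assume "T l \<le> t"
      show "T l \<le> ?m"
      proof (rule ccontr)
        assume "\<not> T l \<le> ?m"
        then have "T l \<in> ?U" using \<open>l \<in> L\<close> by simp
        with t(3) have "t < T l" by (rule bspec)
        with \<open>T l \<le> t\<close> show False by simp
      qed
    next
      show "T l \<le> t" if "T l \<le> ?m" using that t(1) by (rule order_trans)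
    qed
    then show "c l * (if T l \<le> t then 1 else 0) = c l * (if T l \<le> ?m then 1 else 0)" by simp
  qed
  with t show ?thesis by simp
qed

text \<open>Turns sublevel sets of the quantile into conditions on the cdf at a fixed point, from
  which measurability of the quantile follows.\<close>

lemma Qlevel_le_iff:
  assumes "mono F" "\<gamma> \<le> F (Qlevel \<gamma> F)"
  shows "Qlevel \<gamma> F \<le> t \<longleftrightarrow> \<gamma> \<le> F t"
proof
  show "\<gamma> \<le> F t" if "Qlevel \<gamma> F \<le> t" using assms monoD[OF assms(1) that] by linarith
qed (simp add: Qlevel_def Inf_lower)

lemma Qlevel_mono:
  assumes "\<And>t. F t \<le> G t"
  shows "Qlevel \<gamma> G \<le> Qlevel \<gamma> F"
  unfolding Qlevel_def using assms by (intro Inf_superset_mono) (auto intro: order_trans)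

section \<open>Symmetry, monotonicity and measurability of the weighted law\<close>

lemma pro2_weight_pair_key:
  "pair_key b z = pair_key b z' \<Longrightarrow> pro2_weight n b a z = pro2_weight n b a z'"
  by (simp add: pro2_weight_def)

lemma pro2_weight_cong:
  assumes "\<And>i. i < n \<Longrightarrow> b i = b' i" "\<And>i. i < n \<Longrightarrow> a i = a' i" "z \<in> {..<n} \<times> {..<n}"
  shows "pro2_weight n b a z = pro2_weight n b' a' z"
proof -
  have key: "pair_key b w = pair_key b' w" if "w \<in> {..<n} \<times> {..<n}" for w
    using that assms(1) by (auto simp: pair_key_def)
  have I: "{i\<in>{..<n}. \<not> a i} = {i\<in>{..<n}. \<not> a' i}" using assms(2) by auto
  have fibre: "{w \<in> A \<times> A. pair_key b w = pair_key b z} = {w \<in> A \<times> A. pair_key b' w = pair_key b' z}"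
    if "A \<subseteq> {..<n}" for A
    using key assms(3) that by (intro Collect_cong conj_cong refl) (metis Sigma_mono subsetD)
  have "{i\<in>{..<n}. \<not> a' i} \<subseteq> {..<n}" by blast
  then show ?thesis
    by (simp only: pro2_weight_def N0_def I fibre fibre[OF subset_refl])
qed

lemma pro2_cdf_cong:
  assumes "\<And>i. i < n \<Longrightarrow> b i = b' i" "\<And>i. i < n \<Longrightarrow> a i = a' i" "\<And>i. i < n \<Longrightarrow> S i = S' i"
  shows "pro2_cdf n b a S = pro2_cdf n b' a' S'"
proof
  fix t
  show "pro2_cdf n b a S t = pro2_cdf n b' a' S' t"
    unfolding pro2_cdf_eq_weight
    by (rule sum.cong) (auto simp: assms(3) pro2_weight_cong[OF assms(1,2)])
qed

text \<open>A transposition inside a bin preserves the type of every pair, hence its weight;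
  applying it to both components reindexes the sum. The quantile of all scores is therefore
  invariant under such exchanges.\<close>

lemma pro2_cdf_transpose:
  assumes "k < n" "l < n" "b k = b l"
  shows "pro2_cdf n b a (\<lambda>i. S (Transposition.transpose k l i)) = pro2_cdf n b a S"
proof
  fix t
  let ?\<sigma> = "Transposition.transpose k l" and ?P = "{..<n} \<times> {..<n}"
  let ?h = "map_prod ?\<sigma> ?\<sigma>"
  have lt: "?\<sigma> i < n \<longleftrightarrow> i < n" for i using assms by (auto simp: Transposition.transpose_def)
  have b: "b (?\<sigma> i) = b i" for i using assms by (auto simp: Transposition.transpose_def)
  have w: "pro2_weight n b a (?h z) = pro2_weight n b a z" for z
    by (rule pro2_weight_pair_key) (auto simp: pair_key_def b split_beta inj_eq[OF inj_transpose])
  show "pro2_cdf n b a (\<lambda>i. S (?\<sigma> i)) t = pro2_cdf n b a S t"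
    unfolding pro2_cdf_eq_weight
    by (rule sum.reindex_bij_witness[of _ ?h ?h])
      (auto simp: lt w[of "(_, _)", simplified])
qed

lemma pro2_cdf_antimono:
  assumes "\<And>i. S i \<le> S' i"
  shows "pro2_cdf n b a S' t \<le> pro2_cdf n b a S t"
  unfolding pro2_cdf_eq_weight
proof (intro sum_mono mult_left_mono)
  fix z :: "nat \<times> nat"
  have "min (S (fst z)) (S (snd z)) \<le> min (S' (fst z)) (S' (snd z))"
    by (intro min.mono assms)
  then show "(if min (S' (fst z)) (S' (snd z)) \<le> t then 1 else 0)
      \<le> (if min (S (fst z)) (S (snd z)) \<le> t then 1 else (0::real))"
    using order_trans by (simp del: min.bounded_iff) blast
qed (rule pro2_weight_nonneg)

lemma mono_pro2_cdf: "mono (pro2_cdf n b a S)"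
  unfolding pro2_cdf_eq_weight
  by (intro monoI sum_mono mult_left_mono pro2_weight_nonneg) (auto dest: order_trans)

lemma pro2_cdf_Qlevel:
  assumes "\<gamma> \<le> 1" "N0 n a \<noteq> 0"
  shows "\<gamma> \<le> pro2_cdf n b a S (Qlevel \<gamma> (pro2_cdf n b a S))"
  unfolding pro2_cdf_eq_weight
  by (rule weighted_cdf_Qlevel) (simp_all add: sum_pro2_weight[OF assms(2)] assms(1))

lemma measurable_Qlevel_pro2:
  assumes [measurable]: "\<And>i. i < n \<Longrightarrow> (\<lambda>\<omega>. S \<omega> i) \<in> borel_measurable M"
    and "\<gamma> \<le> 1" "N0 n a \<noteq> 0"
  shows "(\<lambda>\<omega>. Qlevel \<gamma> (pro2_cdf n b a (S \<omega>))) \<in> borel_measurable M"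
proof (rule borel_measurableI_le)
  fix t
  have "{\<omega>\<in>space M. \<gamma> \<le> (\<Sum>z\<in>{..<n} \<times> {..<n}.
      pro2_weight n b a z * (if min (S \<omega> (fst z)) (S \<omega> (snd z)) \<le> t then 1 else 0))} \<in> sets M"
  proof -
    have "(\<lambda>\<omega>. pro2_weight n b a z * (if min (S \<omega> (fst z)) (S \<omega> (snd z)) \<le> t then 1 else 0))
        \<in> borel_measurable M" if z: "z \<in> {..<n} \<times> {..<n}" for z
    proof -
      have [measurable]: "(\<lambda>\<omega>. S \<omega> (fst z)) \<in> borel_measurable M" "(\<lambda>\<omega>. S \<omega> (snd z)) \<in> borel_measurable M"
        using z by auto
      show ?thesis by measurable
    qed
    then have [measurable]: "(\<lambda>\<omega>. \<Sum>z\<in>{..<n} \<times> {..<n}.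
      pro2_weight n b a z * (if min (S \<omega> (fst z)) (S \<omega> (snd z)) \<le> t then 1 else 0)) \<in> borel_measurable M"
      by (rule borel_measurable_sum)
    show ?thesis by measurable
  qed
  then show "{\<omega>\<in>space M. Qlevel \<gamma> (pro2_cdf n b a (S \<omega>)) \<le> t} \<in> sets M"
    unfolding Qlevel_le_iff[OF mono_pro2_cdf pro2_cdf_Qlevel[OF assms(2,3)]]
    by (simp only: pro2_cdf_eq_weight)
qed

text \<open>Two scores both exceed \<open>q\<close> exactly when their minimum does, so the sum is
  the mass beyond the quantile. This is a deterministic bound, valid for every realisation of the
  scores.\<close>

lemma Qlevel_pro2_exceedance:
  fixes b :: "nat \<Rightarrow> int" and S :: "nat \<Rightarrow> ereal"
  assumes "\<gamma> \<le> 1" "N0 n a \<noteq> 0"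
  defines "q \<equiv> Qlevel \<gamma> (pro2_cdf n b a S)"
  shows "(\<Sum>z\<in>{..<n} \<times> {..<n}. pro2_weight n b a z * (if q < S (fst z) \<and> q < S (snd z) then 1 else 0))
    \<le> 1 - \<gamma>"
proof -
  have "(\<Sum>z\<in>{..<n} \<times> {..<n}. pro2_weight n b a z * (if q < S (fst z) \<and> q < S (snd z) then 1 else 0))
      = (\<Sum>z\<in>{..<n} \<times> {..<n}. pro2_weight n b a z
          - pro2_weight n b a z * (if min (S (fst z)) (S (snd z)) \<le> q then 1 else 0))"
    by (rule sum.cong) (auto simp: min_le_iff_disj not_less)
  also have "\<dots> = 1 - pro2_cdf n b a S q"
    by (simp only: sum_subtractf sum_pro2_weight[OF assms(2)] pro2_cdf_eq_weight)
  finally show ?thesis using pro2_cdf_Qlevel[OF assms(1,2), of b S] by (simp add: q_def)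
qed

subsection \<open>Exchanging observations within a bin\<close>

lemma ennreal_mult_le:
  assumes "u * v \<le> c * (u' * v')" "0 \<le> u" "0 \<le> v" "0 \<le> c" "0 \<le> u'" "0 \<le> v'"
  shows "ennreal u * ennreal v \<le> ennreal c * (ennreal u' * ennreal v')"
  using assms by (simp add: ennreal_mult[symmetric] ennreal_leI)

section \<open>The law of one observation as a density over the two arms\<close>

locale mar_model =
  fixes PX :: "'x measure" and MY :: "'y measure" and K :: "'x \<Rightarrow> 'y measure"
    and p :: "'x \<Rightarrow> real"
  assumes prob_space_PX: "prob_space PX"
    and measurable_K [measurable]: "K \<in> measurable PX (prob_algebra MY)"
    and measurable_p [measurable]: "p \<in> borel_measurable PX"
    and p_bounds: "\<And>x. x \<in> space PX \<Longrightarrow> 0 < p x \<and> p x < 1"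
begin

abbreviation obs_space :: "('x \<times> 'y \<times> bool) measure" where
  "obs_space \<equiv> PX \<Otimes>\<^sub>M MY \<Otimes>\<^sub>M count_space UNIV"

abbreviation obs :: "('x \<times> 'y \<times> bool) measure" where
  "obs \<equiv> obs_law PX MY K p"

definition xy_law :: "('x \<times> 'y) measure" where
  "xy_law = PX \<bind> (\<lambda>x. K x \<bind> (\<lambda>y. return (PX \<Otimes>\<^sub>M MY) (x, y)))"

text \<open>The conditional probability of arm \<open>a\<close> given the pair \<open>z\<close>. It
  depends on the covariate alone, which is where missingness at random enters.\<close>

definition arm_weight :: "bool \<Rightarrow> 'x \<times> 'y \<Rightarrow> ennreal" where
  "arm_weight a z = ennreal (if a then p (fst z) else 1 - p (fst z))"

lemma PX_in_prob_algebra: "PX \<in> space (prob_algebra PX)"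
  using prob_space_PX by (simp add: space_prob_algebra)

lemma measurable_bernoulli_p [measurable]:
  "(\<lambda>x. measure_pmf (bernoulli_pmf (p x))) \<in> measurable PX (prob_algebra (count_space UNIV))"
proof (rule measurable_prob_algebraI)
  show "(\<lambda>x. measure_pmf (bernoulli_pmf (p x))) \<in> measurable PX (subprob_algebra (count_space UNIV))"
  proof (rule measurable_subprob_algebra)
    fix A :: "bool set"
    have "(\<lambda>x. pmf (bernoulli_pmf (p x)) a) \<in> borel_measurable PX" for a
    \<comment> \<open>The closed form of the Bernoulli mass function requires \<open>p x\<close> to
      be a probability, which is known on the space of \<open>PX\<close>.\<close>
    proof (subst measurable_cong)
      show "pmf (bernoulli_pmf (p x)) a = (if a then p x else 1 - p x)" if "x \<in> space PX" for x
        using p_bounds[OF that] by (cases a) auto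
      show "(\<lambda>x. if a then p x else 1 - p x) \<in> borel_measurable PX" by measurable
    qed
    then show "(\<lambda>x. emeasure (measure_pmf (bernoulli_pmf (p x))) A) \<in> borel_measurable PX"
      by (simp add: emeasure_measure_pmf_finite)
  qed (simp_all add: prob_space_imp_subprob_space measure_pmf.prob_space_axioms)
qed (rule prob_space_measure_pmf)

lemma measurable_arm_weight [measurable]: "arm_weight a \<in> borel_measurable (PX \<Otimes>\<^sub>M MY)"
  unfolding arm_weight_def by measurable

lemma measurable_obs_kernel:
  "(\<lambda>x. K x \<bind> (\<lambda>y. measure_pmf (bernoulli_pmf (p x)) \<bind> (\<lambda>a. return obs_space (x, y, a))))
    \<in> measurable PX (prob_algebra obs_space)"
  by measurable

lemma measurable_xy_kernel:
  "(\<lambda>x. K x \<bind> (\<lambda>y. return (PX \<Otimes>\<^sub>M MY) (x, y))) \<in> measurable PX (prob_algebra (PX \<Otimes>\<^sub>M MY))"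
  by measurable

lemma prob_space_obs: "prob_space obs" and sets_obs [measurable_cong]: "sets obs = sets obs_space"
  unfolding obs_law_def
  using prob_space_bind'[OF PX_in_prob_algebra measurable_obs_kernel]
    sets_bind'[OF PX_in_prob_algebra measurable_obs_kernel] by auto

lemma prob_space_xy_law: "prob_space xy_law"
  and sets_xy_law [measurable_cong]: "sets xy_law = sets (PX \<Otimes>\<^sub>M MY)"
  unfolding xy_law_def
  using prob_space_bind'[OF PX_in_prob_algebra measurable_xy_kernel]
    sets_bind'[OF PX_in_prob_algebra measurable_xy_kernel] by auto

lemma space_obs: "space obs = space PX \<times> space MY \<times> UNIV"
  using sets_eq_imp_space_eq[OF sets_obs] by (simp add: space_pair_measure)

lemma space_xy_law: "space xy_law = space PX \<times> space MY"
  using sets_eq_imp_space_eq[OF sets_xy_law] by (simp add: space_pair_measure)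

lemma sets_K: "x \<in> space PX \<Longrightarrow> sets (K x) = sets MY"
  and space_K: "x \<in> space PX \<Longrightarrow> space (K x) = space MY"
  using measurable_space[OF measurable_K, of x] sets_eq_imp_space_eq[of "K x" MY]
  by (auto simp: space_prob_algebra)

lemma nn_integral_xy_law:
  assumes h [measurable]: "h \<in> borel_measurable (PX \<Otimes>\<^sub>M MY)"
  shows "(\<integral>\<^sup>+z. h z \<partial>xy_law) = (\<integral>\<^sup>+x. \<integral>\<^sup>+y. h (x, y) \<partial>K x \<partial>PX)"
  unfolding xy_law_def
proof (subst nn_integral_bind[OF h measurable_prob_algebraD[OF measurable_xy_kernel]],
    rule nn_integral_cong)
  fix x assume x: "x \<in> space PX"
  note [measurable_cong] = sets_K[OF x]
  have "(\<integral>\<^sup>+z. h z \<partial>(K x \<bind> (\<lambda>y. return (PX \<Otimes>\<^sub>M MY) (x, y))))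
      = (\<integral>\<^sup>+y. \<integral>\<^sup>+z. h z \<partial>return (PX \<Otimes>\<^sub>M MY) (x, y) \<partial>K x)"
    using x by (intro nn_integral_bind[OF h]) measurable
  also have "\<dots> = (\<integral>\<^sup>+y. h (x, y) \<partial>K x)"
    using x by (intro nn_integral_cong nn_integral_return)
      (auto simp: space_pair_measure space_K)
  finally show "(\<integral>\<^sup>+z. h z \<partial>(K x \<bind> (\<lambda>y. return (PX \<Otimes>\<^sub>M MY) (x, y)))) = (\<integral>\<^sup>+y. h (x, y) \<partial>K x)" .
qed

text \<open>The observation law has density \<open>arm_weight\<close> with respect to the product of
  \<open>xy_law\<close> and counting measure on arms. All dependence on the arm thus sits in an
  explicit factor, and the pairs \<open>(X, Y)\<close> can be exchanged freely.\<close>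

lemma nn_integral_obs:
  assumes g [measurable]: "g \<in> borel_measurable obs_space"
  shows "(\<integral>\<^sup>+w. g w \<partial>obs)
    = (\<integral>\<^sup>+z. (\<Sum>a\<in>UNIV. arm_weight a z * g (fst z, snd z, a)) \<partial>xy_law)"
proof -
  have "(\<integral>\<^sup>+w. g w \<partial>obs)
      = (\<integral>\<^sup>+x. \<integral>\<^sup>+y. (\<Sum>a\<in>UNIV. arm_weight a (x, y) * g (x, y, a)) \<partial>K x \<partial>PX)"
    unfolding obs_law_def
  proof (subst nn_integral_bind[OF g measurable_prob_algebraD[OF measurable_obs_kernel]],
      rule nn_integral_cong)
    fix x assume x: "x \<in> space PX"
    note [measurable_cong] = sets_K[OF x]
    let ?B = "measure_pmf (bernoulli_pmf (p x))"
    have "(\<integral>\<^sup>+w. g w \<partial>(K x \<bind> (\<lambda>y. ?B \<bind> (\<lambda>a. return obs_space (x, y, a)))))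
        = (\<integral>\<^sup>+y. \<integral>\<^sup>+w. g w \<partial>(?B \<bind> (\<lambda>a. return obs_space (x, y, a))) \<partial>K x)"
      using x by (intro nn_integral_bind[OF g] measurable_prob_algebraD) measurable
    also have "\<dots> = (\<integral>\<^sup>+y. (\<Sum>a\<in>UNIV. arm_weight a (x, y) * g (x, y, a)) \<partial>K x)"
    proof (rule nn_integral_cong)
      fix y assume "y \<in> space (K x)"
      then have y: "y \<in> space MY" using space_K[OF x] by simp
      have "(\<integral>\<^sup>+w. g w \<partial>(?B \<bind> (\<lambda>a. return obs_space (x, y, a))))
          = (\<integral>\<^sup>+a. \<integral>\<^sup>+w. g w \<partial>return obs_space (x, y, a) \<partial>?B)"
        using x y by (intro nn_integral_bind[OF g] measurable_prob_algebraD) measurable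
      also have "\<dots> = (\<integral>\<^sup>+a. g (x, y, a) \<partial>?B)"
        using x y by (intro nn_integral_cong nn_integral_return) (auto simp: space_pair_measure)
      also have "\<dots> = (\<Sum>a\<in>UNIV. arm_weight a (x, y) * g (x, y, a))"
        using p_bounds[OF x] by (simp add: UNIV_bool arm_weight_def mult.commute add.commute)
      finally show "(\<integral>\<^sup>+w. g w \<partial>(?B \<bind> (\<lambda>a. return obs_space (x, y, a))))
          = (\<Sum>a\<in>UNIV. arm_weight a (x, y) * g (x, y, a))" .
    qed
    finally show "(\<integral>\<^sup>+w. g w \<partial>(K x \<bind> (\<lambda>y. ?B \<bind> (\<lambda>a. return obs_space (x, y, a)))))
        = (\<integral>\<^sup>+y. (\<Sum>a\<in>UNIV. arm_weight a (x, y) * g (x, y, a)) \<partial>K x)" .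
  qed
  also have "\<dots> = (\<integral>\<^sup>+z. (\<Sum>a\<in>UNIV. arm_weight a z * g (fst z, snd z, a)) \<partial>xy_law)"
    by (subst nn_integral_xy_law) simp_all
  finally show ?thesis .
qed

lemma nn_integral_obs_pair:
  assumes g [measurable]: "g \<in> borel_measurable (obs_space \<Otimes>\<^sub>M obs_space)"
  shows "(\<integral>\<^sup>+u. \<integral>\<^sup>+v. g (u, v) \<partial>obs \<partial>obs)
    = (\<integral>\<^sup>+z. \<integral>\<^sup>+z'. (\<Sum>a\<in>UNIV. \<Sum>a'\<in>UNIV.
        arm_weight a z * (arm_weight a' z' * g ((fst z, snd z, a), (fst z', snd z', a')))) \<partial>xy_law \<partial>xy_law)"
proof -
  interpret obs: prob_space obs by (rule prob_space_obs)
  interpret xy: prob_space xy_law by (rule prob_space_xy_law)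
  have "(\<integral>\<^sup>+u. \<integral>\<^sup>+v. g (u, v) \<partial>obs \<partial>obs)
      = (\<integral>\<^sup>+u. \<integral>\<^sup>+z'. (\<Sum>a'\<in>UNIV. arm_weight a' z' * g (u, fst z', snd z', a')) \<partial>xy_law \<partial>obs)"
  proof (rule nn_integral_cong)
    fix u assume "u \<in> space obs"
    then have [measurable]: "u \<in> space obs_space"
      by (simp add: sets_eq_imp_space_eq[OF sets_obs])
    have "(\<lambda>v. g (u, v)) \<in> borel_measurable obs_space" by measurable
    then show "(\<integral>\<^sup>+v. g (u, v) \<partial>obs)
        = (\<integral>\<^sup>+z'. (\<Sum>a'\<in>UNIV. arm_weight a' z' * g (u, fst z', snd z', a')) \<partial>xy_law)"
      by (rule nn_integral_obs)
  qed
  also have "\<dots> = (\<integral>\<^sup>+z. (\<Sum>a\<in>UNIV. arm_weight a z *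
      (\<integral>\<^sup>+z'. (\<Sum>a'\<in>UNIV. arm_weight a' z' * g ((fst z, snd z, a), fst z', snd z', a')) \<partial>xy_law)) \<partial>xy_law)"
    by (rule nn_integral_obs) measurable
  also have "\<dots> = (\<integral>\<^sup>+z. \<integral>\<^sup>+z'. (\<Sum>a\<in>UNIV. \<Sum>a'\<in>UNIV.
      arm_weight a z * (arm_weight a' z' * g ((fst z, snd z, a), (fst z', snd z', a')))) \<partial>xy_law \<partial>xy_law)"
  proof (rule nn_integral_cong)
    fix z assume "z \<in> space xy_law"
    then have [measurable]: "fst z \<in> space PX" "snd z \<in> space MY"
      by (auto simp: space_xy_law)
    let ?h = "\<lambda>a z'. \<Sum>a'\<in>UNIV. arm_weight a' z' * g ((fst z, snd z, a), fst z', snd z', a')"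
    have h: "?h a \<in> borel_measurable xy_law" for a by measurable
    have "(\<Sum>a\<in>UNIV. arm_weight a z * (\<integral>\<^sup>+z'. ?h a z' \<partial>xy_law))
        = (\<Sum>a\<in>UNIV. \<integral>\<^sup>+z'. arm_weight a z * ?h a z' \<partial>xy_law)"
      by (simp only: nn_integral_cmult[OF h])
    also have "\<dots> = (\<integral>\<^sup>+z'. (\<Sum>a\<in>UNIV. arm_weight a z * ?h a z') \<partial>xy_law)"
      by (rule nn_integral_sum[symmetric]) (use h in measurable)
    finally show "(\<Sum>a\<in>UNIV. arm_weight a z * (\<integral>\<^sup>+z'. ?h a z' \<partial>xy_law))
      = (\<integral>\<^sup>+z'. (\<Sum>a\<in>UNIV. \<Sum>a'\<in>UNIV.
        arm_weight a z * (arm_weight a' z' * g ((fst z, snd z, a), (fst z', snd z', a')))) \<partial>xy_law)"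
      by (simp only: sum_distrib_left)
  qed
  finally show ?thesis .
qed

text \<open>The pair \<open>(X, Y)\<close> moves from \<open>v\<close> while the arm of
  \<open>u\<close> stays in place, so an exchange leaves the missingness pattern unchanged.\<close>

definition swap_obs :: "'x \<times> 'y \<times> bool \<Rightarrow> 'x \<times> 'y \<times> bool \<Rightarrow> 'x \<times> 'y \<times> bool" where
  "swap_obs u v = (fst v, fst (snd v), snd (snd u))"

lemma measurable_swap_obs [measurable]:
  "(\<lambda>(u, v). swap_obs u v) \<in> measurable (obs_space \<Otimes>\<^sub>M obs_space) obs_space"
  unfolding swap_obs_def by measurable

text \<open>After summing out the arms, swapping the two integration variables undoes the exchange
  inside \<open>g\<close> and moves it to the arm weights. Where \<open>g\<close> is nonzero both
  units share a bin, so these weights change by a factor of at most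
  \<open>1 + \<epsilon>\<close>.\<close>

lemma nn_integral_obs_swap_le:
  assumes g [measurable]: "g \<in> borel_measurable (obs_space \<Otimes>\<^sub>M obs_space)"
    and "0 < \<epsilon>"
    and supp: "\<And>u v. u \<in> space obs \<Longrightarrow> v \<in> space obs \<Longrightarrow> g (u, v) \<noteq> 0
      \<Longrightarrow> bin \<epsilon> (p (fst u)) = bin \<epsilon> (p (fst v))"
  shows "(\<integral>\<^sup>+u. \<integral>\<^sup>+v. g (swap_obs u v, swap_obs v u) \<partial>obs \<partial>obs)
    \<le> ennreal (1 + \<epsilon>) * (\<integral>\<^sup>+u. \<integral>\<^sup>+v. g (u, v) \<partial>obs \<partial>obs)"
proof -
  interpret xy: prob_space xy_law by (rule prob_space_xy_law)
  interpret pair_sigma_finite xy_law xy_law ..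
  let ?G = "\<lambda>z z' a a'. g ((fst z, snd z, a), (fst z', snd z', a'))"
  have g': "(\<lambda>w. g (swap_obs (fst w) (snd w), swap_obs (snd w) (fst w)))
      \<in> borel_measurable (obs_space \<Otimes>\<^sub>M obs_space)"
    by measurable
  have "(\<integral>\<^sup>+u. \<integral>\<^sup>+v. g (swap_obs u v, swap_obs v u) \<partial>obs \<partial>obs)
      = (\<integral>\<^sup>+z. \<integral>\<^sup>+z'. (\<Sum>a\<in>UNIV. \<Sum>a'\<in>UNIV.
          arm_weight a z * (arm_weight a' z' * ?G z' z a a')) \<partial>xy_law \<partial>xy_law)"
    using nn_integral_obs_pair[OF g'] by (simp add: swap_obs_def)
  \<comment> \<open>With the order of integration reversed, \<open>z'\<close> is the pair in the
    first slot of \<open>g\<close>, as in the expansion of the right-hand side.\<close>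
  also have "\<dots> = (\<integral>\<^sup>+z'. \<integral>\<^sup>+z. (\<Sum>a\<in>UNIV. \<Sum>a'\<in>UNIV.
          arm_weight a z * (arm_weight a' z' * ?G z' z a a')) \<partial>xy_law \<partial>xy_law)"
    by (rule Fubini'[symmetric]) measurable
  also have "\<dots> \<le> (\<integral>\<^sup>+z'. \<integral>\<^sup>+z. ennreal (1 + \<epsilon>) * (\<Sum>a\<in>UNIV. \<Sum>a'\<in>UNIV.
          arm_weight a z' * (arm_weight a' z * ?G z' z a a')) \<partial>xy_law \<partial>xy_law)"
  proof (intro nn_integral_mono)
    fix z z' assume "z \<in> space xy_law" "z' \<in> space xy_law"
    then have z: "fst z \<in> space PX" "snd z \<in> space MY" "fst z' \<in> space PX" "snd z' \<in> space MY"
      by (auto simp: space_xy_law)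
    have "arm_weight a z * (arm_weight a' z' * ?G z' z a a')
        \<le> ennreal (1 + \<epsilon>) * (arm_weight a z' * (arm_weight a' z * ?G z' z a a'))" for a a'
    proof (cases "?G z' z a a' = 0")
      case False
      then have bins: "bin \<epsilon> (p (fst z')) = bin \<epsilon> (p (fst z))"
        using supp[OF _ _ False] z by (simp add: space_obs)
      define q where "q = p (fst z)"
      define r where "r = p (fst z')"
      have qr: "0 < q" "q < 1" "0 < r" "r < 1"
        using p_bounds z unfolding q_def r_def by auto
      \<comment> \<open>Equal arms give the same product on both sides, leaving a slack of
        \<epsilon> times one of these terms; opposite arms are the two cases of
        \<open>bin_eq_odds_le\<close>.\<close>
      have nonneg: "0 \<le> q * r" "0 \<le> (1 - q) * (1 - r)" using qr by simp_all
      have "(if a then q else 1 - q) * (if a' then r else 1 - r)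
          \<le> (1 + \<epsilon>) * ((if a then r else 1 - r) * (if a' then q else 1 - q))"
        using bin_eq_odds_le[OF assms(2), of q r] bin_eq_odds_le[OF assms(2), of r q] bins qr
          mult_nonneg_nonneg[OF less_imp_le[OF assms(2)] nonneg(1)]
          mult_nonneg_nonneg[OF less_imp_le[OF assms(2)] nonneg(2)]
        by (auto simp: q_def[symmetric] r_def[symmetric] algebra_simps)
      then have "arm_weight a z * arm_weight a' z'
          \<le> ennreal (1 + \<epsilon>) * (arm_weight a z' * arm_weight a' z)"
        unfolding arm_weight_def q_def[symmetric] r_def[symmetric] using qr assms(2)
        by (intro ennreal_mult_le) auto
      from mult_right_mono[OF this, of "?G z' z a a'"] show ?thesis
        by (simp add: mult.assoc)
    qed simp
    then show "(\<Sum>a\<in>UNIV. \<Sum>a'\<in>UNIV. arm_weight a z * (arm_weight a' z' * ?G z' z a a'))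
        \<le> ennreal (1 + \<epsilon>) * (\<Sum>a\<in>UNIV. \<Sum>a'\<in>UNIV. arm_weight a z' * (arm_weight a' z * ?G z' z a a'))"
      by (simp add: sum_distrib_left sum_mono)
  qed
  also have "\<dots> = ennreal (1 + \<epsilon>) * (\<integral>\<^sup>+z'. \<integral>\<^sup>+z. (\<Sum>a\<in>UNIV. \<Sum>a'\<in>UNIV.
          arm_weight a z' * (arm_weight a' z * ?G z' z a a')) \<partial>xy_law \<partial>xy_law)"
  proof -
    let ?F = "\<lambda>z' z. \<Sum>a\<in>UNIV. \<Sum>a'\<in>UNIV. arm_weight a z' * (arm_weight a' z * ?G z' z a a')"
    have [measurable]: "case_prod ?F \<in> borel_measurable (xy_law \<Otimes>\<^sub>M xy_law)" by measurable
    have "(\<integral>\<^sup>+z'. \<integral>\<^sup>+z. ennreal (1 + \<epsilon>) * ?F z' z \<partial>xy_law \<partial>xy_law)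
        = (\<integral>\<^sup>+z'. ennreal (1 + \<epsilon>) * (\<integral>\<^sup>+z. ?F z' z \<partial>xy_law) \<partial>xy_law)"
      by (intro nn_integral_cong nn_integral_cmult
          measurable_Pair2[of "case_prod ?F", simplified]) measurable
    also have "\<dots> = ennreal (1 + \<epsilon>) * (\<integral>\<^sup>+z'. \<integral>\<^sup>+z. ?F z' z \<partial>xy_law \<partial>xy_law)"
      by (rule nn_integral_cmult, rule xy.borel_measurable_nn_integral) measurable
    finally show ?thesis .
  qed
  also have "\<dots> = ennreal (1 + \<epsilon>) * (\<integral>\<^sup>+u. \<integral>\<^sup>+v. g (u, v) \<partial>obs \<partial>obs)"
    by (simp add: nn_integral_obs_pair[OF g])
  finally show ?thesis .
qed

text \<open>Away from \<open>i\<close> and \<open>j\<close> the transposition fixes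
  \<open>k\<close>, and \<open>swap_obs\<close> of an observation with itself returns it, so one
  formula covers all coordinates.\<close>

definition swap_xy :: "nat \<Rightarrow> nat \<Rightarrow> (nat \<Rightarrow> 'x \<times> 'y \<times> bool) \<Rightarrow> nat \<Rightarrow> 'x \<times> 'y \<times> bool" where
  "swap_xy i j \<omega> = (\<lambda>k. swap_obs (\<omega> k) (\<omega> (Transposition.transpose i j k)))"

lemma swap_xy_upd:
  "i \<noteq> j \<Longrightarrow> swap_xy i j (\<eta>(i := u, j := v)) = \<eta>(i := swap_obs u v, j := swap_obs v u)"
  by (auto simp: swap_xy_def swap_obs_def Transposition.transpose_def fun_eq_iff)

lemma measurable_swap_xy:
  assumes "i \<in> I" "j \<in> I"
  shows "swap_xy i j \<in> measurable (PiM I (\<lambda>_. obs)) (PiM I (\<lambda>_. obs))"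
  unfolding swap_xy_def
proof (rule measurable_PiM_single')
  fix k assume "k \<in> I"
  then have [measurable]: "k \<in> I" "Transposition.transpose i j k \<in> I" using assms by (auto simp: Transposition.transpose_def)
  show "(\<lambda>\<omega>. swap_obs (\<omega> k) (\<omega> (Transposition.transpose i j k))) \<in> measurable (PiM I (\<lambda>_. obs)) obs"
    by measurable
next
  show "(\<lambda>\<omega> k. swap_obs (\<omega> k) (\<omega> (Transposition.transpose i j k)))
      \<in> space (PiM I (\<lambda>_. obs)) \<rightarrow> (\<Pi>\<^sub>E i\<in>I. space obs)"
  proof (rule Pi_I, rule PiE_I)
    fix \<omega> k assume w: "\<omega> \<in> space (PiM I (\<lambda>_. obs))"
    show "swap_obs (\<omega> k) (\<omega> (Transposition.transpose i j k)) \<in> space obs" if k: "k \<in> I"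
    proof -
      have "Transposition.transpose i j k \<in> I" using k assms by (auto simp: Transposition.transpose_def)
      then have "\<omega> k \<in> space obs" "\<omega> (Transposition.transpose i j k) \<in> space obs"
        using w k by (auto simp: space_PiM)
      then show ?thesis by (auto simp: swap_obs_def space_obs)
    qed
    \<comment> \<open>Membership in the product space needs extensionality: outside \<open>I\<close>
      the value \<open>undefined\<close> is exchanged with itself.\<close>
    show "swap_obs (\<omega> k) (\<omega> (Transposition.transpose i j k)) = undefined" if k: "k \<notin> I"
    proof -
      have "Transposition.transpose i j k = k" using k assms by (auto simp: Transposition.transpose_def)
      moreover have "\<omega> k = undefined" using PiE_arb[OF w[unfolded space_PiM] k] .
      ultimately show ?thesis by (simp add: swap_obs_def)
    qed
  qed
qed

lemma nn_integral_swap_xy_le: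
  assumes "finite I" "i \<in> I" "j \<in> I" "i \<noteq> j"
    and f: "f \<in> borel_measurable (PiM I (\<lambda>_. obs))"
    and "0 < \<epsilon>"
    and supp: "\<And>\<eta>. \<eta> \<in> space (PiM I (\<lambda>_. obs)) \<Longrightarrow> f \<eta> \<noteq> 0
      \<Longrightarrow> bin \<epsilon> (p (fst (\<eta> i))) = bin \<epsilon> (p (fst (\<eta> j)))"
  shows "(\<integral>\<^sup>+\<eta>. f (swap_xy i j \<eta>) \<partial>PiM I (\<lambda>_. obs))
    \<le> ennreal (1 + \<epsilon>) * (\<integral>\<^sup>+\<eta>. f \<eta> \<partial>PiM I (\<lambda>_. obs))"
proof -
  interpret obs: prob_space obs by (rule prob_space_obs)
  interpret product_sigma_finite "\<lambda>_::nat. obs" ..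
  define J where "J = I - {i, j}"
  have J: "finite J" "i \<notin> J" "j \<notin> insert i J" and I: "I = insert j (insert i J)"
    using assms(1-4) by (auto simp: J_def)
  have expand: "(\<integral>\<^sup>+\<eta>. h \<eta> \<partial>PiM I (\<lambda>_. obs))
      = (\<integral>\<^sup>+\<eta>. \<integral>\<^sup>+u. \<integral>\<^sup>+v. h (\<eta>(i := u, j := v)) \<partial>obs \<partial>obs \<partial>PiM J (\<lambda>_. obs))"
    if h: "h \<in> borel_measurable (PiM I (\<lambda>_. obs))" for h
  proof -
    have [measurable]: "h \<in> borel_measurable (PiM (insert j (insert i J)) (\<lambda>_. obs))"
      using h by (simp add: I)
    show ?thesis
      unfolding I using J
      by (subst product_nn_integral_insert, simp, simp, measurable)
        (subst product_nn_integral_insert, simp_all)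
  qed
  have "(\<integral>\<^sup>+u. \<integral>\<^sup>+v. f (swap_xy i j (\<eta>(i := u, j := v))) \<partial>obs \<partial>obs)
      \<le> ennreal (1 + \<epsilon>) * (\<integral>\<^sup>+u. \<integral>\<^sup>+v. f (\<eta>(i := u, j := v)) \<partial>obs \<partial>obs)"
    if w: "\<eta> \<in> space (PiM J (\<lambda>_. obs))" for \<eta>
  proof -
    let ?g = "\<lambda>w. f (\<eta>(i := fst w, j := snd w))"
    have [measurable]: "f \<in> borel_measurable (PiM (insert j (insert i J)) (\<lambda>_. obs))"
      using f by (simp add: I)
    have upd: "(\<lambda>w. \<eta>(i := fst w, j := snd w))
        \<in> measurable (obs_space \<Otimes>\<^sub>M obs_space) (PiM (insert j (insert i J)) (\<lambda>_. obs))"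
    proof -
      have "(\<lambda>w. \<eta>(i := fst w)) \<in> measurable (obs \<Otimes>\<^sub>M obs) (PiM (insert i J) (\<lambda>_. obs))"
        by (rule measurable_compose[OF measurable_fst measurable_component_update[OF w J(2)]])
      from measurable_compose[OF measurable_Pair[OF this measurable_snd]
          measurable_add_dim[of j "insert i J" "\<lambda>_. obs"]]
      have "(\<lambda>w. \<eta>(i := fst w, j := snd w))
          \<in> measurable (obs \<Otimes>\<^sub>M obs) (PiM (insert j (insert i J)) (\<lambda>_. obs))"
        by simp
      then show ?thesis
        by (simp add: measurable_cong_sets[OF sets_pair_measure_cong[OF sets_obs sets_obs] refl])
    qed
    have g: "?g \<in> borel_measurable (obs_space \<Otimes>\<^sub>M obs_space)"
      by (rule measurable_compose[OF upd]) measurable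
    have "(\<integral>\<^sup>+u. \<integral>\<^sup>+v. ?g (swap_obs u v, swap_obs v u) \<partial>obs \<partial>obs)
        \<le> ennreal (1 + \<epsilon>) * (\<integral>\<^sup>+u. \<integral>\<^sup>+v. ?g (u, v) \<partial>obs \<partial>obs)"
    proof (rule nn_integral_obs_swap_le[OF g assms(6)])
      fix u v assume uv: "u \<in> space obs" "v \<in> space obs" and nz: "?g (u, v) \<noteq> 0"
      have "\<eta>(i := u, j := v) \<in> space (PiM I (\<lambda>_. obs))"
        using w uv unfolding I by (auto simp: space_PiM PiE_iff extensional_def)
      from supp[OF this] nz assms(4) show "bin \<epsilon> (p (fst u)) = bin \<epsilon> (p (fst v))" by simp
    qed
    then show ?thesis using assms(4) by (simp add: swap_xy_upd)
  qed
  then have "(\<integral>\<^sup>+\<eta>. f (swap_xy i j \<eta>) \<partial>PiM I (\<lambda>_. obs))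
      \<le> (\<integral>\<^sup>+\<eta>. ennreal (1 + \<epsilon>) * (\<integral>\<^sup>+u. \<integral>\<^sup>+v. f (\<eta>(i := u, j := v)) \<partial>obs \<partial>obs) \<partial>PiM J (\<lambda>_. obs))"
    by (subst expand[OF measurable_compose[OF measurable_swap_xy[OF assms(2,3)] f]])
      (rule nn_integral_mono)
  also have "\<dots> = ennreal (1 + \<epsilon>) * (\<integral>\<^sup>+\<eta>. f \<eta> \<partial>PiM I (\<lambda>_. obs))"
  proof -
    have [measurable]: "f \<in> borel_measurable (PiM (insert j (insert i J)) (\<lambda>_. obs))"
      using f by (simp add: I)
    show ?thesis by (subst expand[OF f], rule nn_integral_cmult) measurable
  qed
  finally show ?thesis .
qed

end

subsection \<open>Joint exceedances\<close>

locale mar_score = mar_model PX MY K p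
  for PX :: "'x measure" and MY :: "'y measure" and K and p :: "'x \<Rightarrow> real" +
  fixes s :: "'x \<Rightarrow> 'y \<Rightarrow> real" and n :: nat and \<alpha> \<epsilon> :: real
  assumes measurable_s [measurable]: "(\<lambda>(x, y). s x y) \<in> borel_measurable (PX \<Otimes>\<^sub>M MY)"
    and eps_pos: "0 < \<epsilon>" and alpha_pos: "0 < \<alpha>" and alpha_less_1: "\<alpha> < 1"
begin

abbreviation sample :: "(nat \<Rightarrow> 'x \<times> 'y \<times> bool) measure" where
  "sample \<equiv> PiM {..<n} (\<lambda>_. obs)"

definition score :: "(nat \<Rightarrow> 'x \<times> 'y \<times> bool) \<Rightarrow> nat \<Rightarrow> real" where
  "score \<omega> i = s (fst (\<omega> i)) (fst (snd (\<omega> i)))"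

definition atom :: "(nat \<Rightarrow> int) \<Rightarrow> (nat \<Rightarrow> bool) \<Rightarrow> (nat \<Rightarrow> 'x \<times> 'y \<times> bool) set" where
  "atom b a = {\<omega>\<in>space sample. \<forall>i<n. Bvec \<epsilon> p \<omega> i = b i \<and> Avec \<omega> i = a i}"

text \<open>An oracle quantity that also uses the unobserved scores. Unlike
  \<open>masked_quantile\<close>, it does not depend on which scores inside a bin are masked. Bins
  and arms are parameters rather than read off the sample, so its symmetry is exact.\<close>

definition full_quantile :: "(nat \<Rightarrow> int) \<Rightarrow> (nat \<Rightarrow> bool) \<Rightarrow> (nat \<Rightarrow> 'x \<times> 'y \<times> bool) \<Rightarrow> ereal" where
  "full_quantile b a \<omega> = Qlevel (1 - \<alpha>\<^sup>2) (pro2_cdf n b a (\<lambda>i. ereal (score \<omega> i)))"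

definition masked_quantile :: "(nat \<Rightarrow> int) \<Rightarrow> (nat \<Rightarrow> bool) \<Rightarrow> (nat \<Rightarrow> 'x \<times> 'y \<times> bool) \<Rightarrow> ereal" where
  "masked_quantile b a \<omega>
    = Qlevel (1 - \<alpha>\<^sup>2) (pro2_cdf n b a (\<lambda>i. if a i then ereal (score \<omega> i) else \<infinity>))"

definition exceed :: "(nat \<Rightarrow> int) \<Rightarrow> (nat \<Rightarrow> bool) \<Rightarrow> nat \<times> nat \<Rightarrow> (nat \<Rightarrow> 'x \<times> 'y \<times> bool) set" where
  "exceed b a z = {\<omega>\<in>atom b a.
    full_quantile b a \<omega> < score \<omega> (fst z) \<and> full_quantile b a \<omega> < score \<omega> (snd z)}"

lemma prob_space_sample: "prob_space sample"
  by (rule prob_space_PiM) (rule prob_space_obs)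

lemma measurable_bin_p [measurable]: "(\<lambda>x. bin \<epsilon> (p x)) \<in> measurable PX (count_space UNIV)"
proof (subst measurable_cong)
  show "bin \<epsilon> (p x) = \<lfloor>log (1 + \<epsilon>) (p x / (1 - p x))\<rfloor>" if "x \<in> space PX" for x
    using p_bounds[OF that] eps_pos by (simp add: bin_eq_floor)
  show "(\<lambda>x. \<lfloor>log (1 + \<epsilon>) (p x / (1 - p x))\<rfloor>) \<in> measurable PX (count_space UNIV)"
    by measurable
qed

lemma measurable_coords [measurable]:
  assumes "i < n"
  shows "(\<lambda>\<omega>. score \<omega> i) \<in> borel_measurable sample"
    and "(\<lambda>\<omega>. Bvec \<epsilon> p \<omega> i) \<in> measurable sample (count_space UNIV)"
    and "(\<lambda>\<omega>. Avec \<omega> i) \<in> measurable sample (count_space UNIV)"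
proof -
  have [measurable]: "(\<lambda>\<omega>. \<omega> i) \<in> measurable sample obs_space"
    using measurable_component_singleton[of i "{..<n}" "\<lambda>_. obs"] assms
    by (simp add: measurable_cong_sets[OF refl sets_obs])
  have "(\<lambda>\<omega>. (\<lambda>(x, y). s x y) (fst (\<omega> i), fst (snd (\<omega> i)))) \<in> borel_measurable sample"
    by measurable
  then show "(\<lambda>\<omega>. score \<omega> i) \<in> borel_measurable sample" by (simp add: score_def)
  show "(\<lambda>\<omega>. Bvec \<epsilon> p \<omega> i) \<in> measurable sample (count_space UNIV)"
    unfolding Bvec_def by measurable
  show "(\<lambda>\<omega>. Avec \<omega> i) \<in> measurable sample (count_space UNIV)"
    unfolding Avec_def by measurable
qed

lemma atom_in_sets [measurable]: "atom b a \<in> sets sample"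
proof -
  have "atom b a = {\<omega>\<in>space sample. \<forall>i\<in>{..<n}. Bvec \<epsilon> p \<omega> i = b i \<and> Avec \<omega> i = a i}"
    by (auto simp: atom_def)
  also have "\<dots> \<in> sets sample"
  proof (rule sets.sets_Collect_finite_All)
    fix i assume "i \<in> {..<n}"
    then have [measurable]: "i < n" by simp
    show "{\<omega>\<in>space sample. Bvec \<epsilon> p \<omega> i = b i \<and> Avec \<omega> i = a i} \<in> sets sample" by measurable
  qed simp
  finally show ?thesis .
qed

lemma level_le_1: "1 - \<alpha>\<^sup>2 \<le> 1"
  by simp

lemma measurable_quantiles:
  assumes "N0 n a \<noteq> 0"
  shows "full_quantile b a \<in> borel_measurable sample"
    and "masked_quantile b a \<in> borel_measurable sample"
  unfolding full_quantile_def masked_quantile_def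
  by (rule measurable_Qlevel_pro2[OF _ level_le_1 assms], measurable)+

lemma exceed_in_sets:
  assumes "N0 n a \<noteq> 0" "fst z < n" "snd z < n"
  shows "exceed b a z \<in> sets sample"
proof -
  note [measurable] = measurable_quantiles[OF assms(1)] assms(2,3)
  have "exceed b a z = atom b a \<inter> {\<omega>\<in>space sample.
      full_quantile b a \<omega> < score \<omega> (fst z) \<and> full_quantile b a \<omega> < score \<omega> (snd z)}"
    by (auto simp: exceed_def atom_def)
  then show ?thesis by simp
qed

lemma swap_xy_coords:
  "score (swap_xy k l \<omega>) i = score \<omega> (Transposition.transpose k l i)"
  "Bvec \<epsilon> p (swap_xy k l \<omega>) i = Bvec \<epsilon> p \<omega> (Transposition.transpose k l i)"
  "Avec (swap_xy k l \<omega>) i = Avec \<omega> i"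
  by (simp_all add: score_def Bvec_def Avec_def swap_xy_def swap_obs_def)

text \<open>Within a bin the exchange preserves the atom, because bin labels agree and arms stay
  put, and it preserves the full quantile; only the two tested scores change position.\<close>

lemma swap_xy_in_exceed:
  assumes "k < n" "l < n" "b k = b l" "\<omega> \<in> space sample"
  shows "swap_xy k l \<omega> \<in> exceed b a (i, j)
    \<longleftrightarrow> \<omega> \<in> exceed b a (Transposition.transpose k l i, Transposition.transpose k l j)"
proof -
  let ?\<sigma> = "Transposition.transpose k l"
  have lt: "?\<sigma> i < n \<longleftrightarrow> i < n" and b: "b (?\<sigma> i) = b i" for i
    using assms(1-3) by (auto simp: Transposition.transpose_def)
  have "swap_xy k l \<omega> \<in> space sample"
    using measurable_space[OF measurable_swap_xy assms(4)] assms(1,2) by simp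
  moreover have "(\<forall>i<n. Bvec \<epsilon> p \<omega> (?\<sigma> i) = b i) \<longleftrightarrow> (\<forall>i<n. Bvec \<epsilon> p \<omega> i = b i)"
    by (metis lt b transpose_involutory)
  ultimately have "swap_xy k l \<omega> \<in> atom b a \<longleftrightarrow> \<omega> \<in> atom b a"
    using assms(4) by (auto simp: atom_def swap_xy_coords)
  moreover have "full_quantile b a (swap_xy k l \<omega>) = full_quantile b a \<omega>"
    unfolding full_quantile_def swap_xy_coords
    using pro2_cdf_transpose[OF assms(1-3), of a "\<lambda>i. ereal (score \<omega> i)"] by simp
  ultimately show ?thesis by (simp add: exceed_def swap_xy_coords)
qed

text \<open>The bound for exchanges is applied to the indicator of \<open>exceed b a (i, j)\<close>,
  whose composition with the exchange is the indicator of the event for the transposed pair.\<close>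

lemma prob_exceed_transpose_le:
  assumes "N0 n a \<noteq> 0" "k < n" "l < n" "b k = b l" "i < n" "j < n"
  shows "measure sample (exceed b a (Transposition.transpose k l i, Transposition.transpose k l j))
    \<le> (1 + \<epsilon>) * measure sample (exceed b a (i, j))"
proof (cases "k = l")
  case True
  then show ?thesis using eps_pos by (simp add: algebra_simps)
next
  case False
  interpret prob_space sample by (rule prob_space_sample)
  let ?\<sigma> = "Transposition.transpose k l"
  let ?f = "indicator (exceed b a (i, j)) :: _ \<Rightarrow> ennreal"
  have sets: "exceed b a (i, j) \<in> sets sample" "exceed b a (?\<sigma> i, ?\<sigma> j) \<in> sets sample"
    using assms by (auto intro!: exceed_in_sets simp: Transposition.transpose_def)
  have "(\<integral>\<^sup>+\<omega>. ?f (swap_xy k l \<omega>) \<partial>sample) \<le> ennreal (1 + \<epsilon>) * (\<integral>\<^sup>+\<omega>. ?f \<omega> \<partial>sample)"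
  proof (rule nn_integral_swap_xy_le)
    fix \<omega> assume "?f \<omega> \<noteq> 0"
    then have "\<omega> \<in> atom b a" by (auto simp: exceed_def split: split_indicator_asm)
    then show "bin \<epsilon> (p (fst (\<omega> k))) = bin \<epsilon> (p (fst (\<omega> l)))"
      using assms(2-4) by (auto simp: atom_def Bvec_def)
  qed (use assms False sets eps_pos in auto)
  also have "(\<integral>\<^sup>+\<omega>. ?f (swap_xy k l \<omega>) \<partial>sample)
      = (\<integral>\<^sup>+\<omega>. indicator (exceed b a (?\<sigma> i, ?\<sigma> j)) \<omega> \<partial>sample)"
    by (rule nn_integral_cong) (simp add: indicator_def swap_xy_in_exceed[OF assms(2-4)])
  finally have "emeasure sample (exceed b a (?\<sigma> i, ?\<sigma> j))
      \<le> ennreal (1 + \<epsilon>) * emeasure sample (exceed b a (i, j))"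
    using sets by simp
  then show ?thesis
    using eps_pos by (simp add: emeasure_eq_measure ennreal_mult[symmetric] del: ennreal_plus)
qed

text \<open>Two transpositions inside bins carry one pair to the other: the first sends
  \<open>i\<close> to \<open>i'\<close>, the second corrects the second index while fixing
  \<open>i'\<close>. Each costs a factor \<open>1 + \<epsilon>\<close>.\<close>

lemma prob_exceed_pair_key_le:
  assumes "N0 n a \<noteq> 0" and lt: "i < n" "j < n" "i' < n" "j' < n"
    and key: "pair_key b (i', j') = pair_key b (i, j)"
  shows "measure sample (exceed b a (i, j)) \<le> (1 + \<epsilon>)\<^sup>2 * measure sample (exceed b a (i', j'))"
proof -
  have b: "b i = b i'" "b j = b j'" and eq: "i' = j' \<longleftrightarrow> i = j"
    using key by (auto simp: pair_key_def)
  \<comment> \<open>The position of the second index after the first transposition. It still lies in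
    the bin of \<open>j'\<close>.\<close>
  define m where "m = Transposition.transpose i i' j"
  have "j = i \<and> m = i' \<or> j = i' \<and> m = i \<or> m = j"
    by (simp add: m_def Transposition.transpose_def)
  then have m: "m < n" "b m = b j'" using lt b by metis+
  have "measure sample (exceed b a (i, j)) \<le> (1 + \<epsilon>) * measure sample (exceed b a (i', m))"
    using prob_exceed_transpose_le[OF assms(1) lt(1,3) b(1) lt(3) m(1)]
    by (simp add: m_def)
  also have "measure sample (exceed b a (i', m)) \<le> (1 + \<epsilon>) * measure sample (exceed b a (i', j'))"
  \<comment> \<open>For a diagonal pair the first transposition already moves both indices to the
    target. Otherwise \<open>i'\<close> differs from both \<open>m\<close> and \<open>j'\<close>, so
    the second transposition leaves it alone.\<close>
  proof (cases "i = j")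
    case True
    then have "m = j'" using eq by (simp add: m_def)
    then show ?thesis using eps_pos by (simp add: algebra_simps)
  next
    case False
    then have "m \<noteq> i'" by (auto simp: m_def Transposition.transpose_def split: if_splits)
    then have "Transposition.transpose m j' i' = i'"
      using False eq by (auto simp: Transposition.transpose_def)
    then show ?thesis
      using prob_exceed_transpose_le[OF assms(1) m(1) lt(4) m(2) lt(3,4)] by simp
  qed
  finally show ?thesis using eps_pos by (simp add: power2_eq_square mult.assoc)
qed

end

subsection \<open>The conditional second moment\<close>

text \<open>When \<alpha> squared plus 2\<epsilon> is at least 1, the trivial bound suffices.
  Otherwise \<epsilon> is less than half of \<open>1 - u\<close>, which forces
  \<open>(2 + \<epsilon>) * u \<le> 2\<close>, and this controls the excess
  \<open>\<epsilon> * (2 + \<epsilon>) * u\<close> over \<open>u\<close> by 2\<epsilon>.\<close>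

lemma inflation_bound:
  fixes \<alpha> \<epsilon> x :: real
  assumes "0 < \<alpha>" "\<alpha> < 1" "0 < \<epsilon>" "0 \<le> m" "x \<le> m" "x \<le> (1 + \<epsilon>)\<^sup>2 * (\<alpha>\<^sup>2 * m)"
  shows "x \<le> (\<alpha>\<^sup>2 + 2 * \<epsilon>) * m"
proof -
  define u where "u = \<alpha>\<^sup>2"
  have u: "0 < u" "u < 1" using assms(1,2) by (auto simp: u_def power_less_one_iff)
  show ?thesis
  proof (cases "1 \<le> u + 2 * \<epsilon>")
    case True
    from mult_right_mono[OF this assms(4)] assms(5) show ?thesis by (simp add: u_def)
  next
    case False
    have "\<epsilon> * u \<le> 1 * ((1 - u) / 2)" using False u assms(3) mult_mono[of \<epsilon> "(1 - u) / 2" u 1] by simp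
    then have "(2 + \<epsilon>) * u \<le> 2" using u by (simp add: algebra_simps)
    from mult_left_mono[OF this, of \<epsilon>] have "(1 + \<epsilon>)\<^sup>2 * u \<le> u + 2 * \<epsilon>"
      using assms(3) by (simp add: power2_eq_square algebra_simps)
    from mult_right_mono[OF this assms(4)] assms(6) show ?thesis by (simp add: u_def mult.assoc)
  qed
qed

context mar_score
begin

text \<open>On an atom the random bins and arms become constants, so the miscoverage depends on the
  sample only through the scores.\<close>

lemma miscov_on_atom:
  assumes "\<omega> \<in> atom b a"
  shows "miscov n \<alpha> \<epsilon> p s \<omega> = (if N0 n a = 0 then 0 else
    (1 / N0 n a) * (\<Sum>i\<in>{i\<in>{..<n}. \<not> a i}. if masked_quantile b a \<omega> < score \<omega> i then 1 else 0))"
proof -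
  have ba: "Bvec \<epsilon> p \<omega> i = b i" "Avec \<omega> i = a i" if "i < n" for i
    using assms that by (auto simp: atom_def)
  have I: "{i\<in>{..<n}. \<not> Avec \<omega> i} = {i\<in>{..<n}. \<not> a i}" using ba by auto
  have S: "Sbar s \<omega> i = (if a i then ereal (score \<omega> i) else \<infinity>)" if "i < n" for i
    using ba(2)[OF that] by (simp add: Sbar_def score_def Avec_def)
  have "pro2_cdf n (Bvec \<epsilon> p \<omega>) (Avec \<omega>) (Sbar s \<omega>)
      = pro2_cdf n b a (\<lambda>i. if a i then ereal (score \<omega> i) else \<infinity>)"
    by (rule pro2_cdf_cong) (simp_all add: ba S)
  then have "Qpro2 n \<alpha> \<epsilon> p s \<omega> = masked_quantile b a \<omega>"
    by (simp add: Qpro2_def masked_quantile_def)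
  then show ?thesis
    unfolding miscov_def N0_def I by (simp add: Cpro2_def score_def not_le)
qed

definition bin_arm :: "(nat \<Rightarrow> 'x \<times> 'y \<times> bool) \<Rightarrow> nat \<Rightarrow> int \<times> bool" where
  "bin_arm \<omega> = (\<lambda>i\<in>{..<n}. (Bvec \<epsilon> p \<omega> i, Avec \<omega> i))"

lemma atom_eq_bin_arm:
  assumes "v \<in> {..<n} \<rightarrow>\<^sub>E UNIV"
  shows "atom (fst \<circ> v) (snd \<circ> v) = bin_arm -` {v} \<inter> space sample"
proof -
  have "bin_arm \<omega> = v \<longleftrightarrow> (\<forall>i<n. Bvec \<epsilon> p \<omega> i = fst (v i) \<and> Avec \<omega> i = snd (v i))" for \<omega>
    using PiE_arb[OF assms] by (auto simp: bin_arm_def fun_eq_iff restrict_def prod_eq_iff)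
  then show ?thesis by (auto simp: atom_def)
qed

text \<open>The conditioning vector takes countably many values, so measurability and almost sure
  statements can be treated one atom at a time.\<close>

lemma countable_bin_arm: "countable (({..<n} \<rightarrow>\<^sub>E UNIV) :: (nat \<Rightarrow> int \<times> bool) set)"
  by (rule countable_PiE) simp_all

lemma bin_arm_in_PiE: "bin_arm \<omega> \<in> {..<n} \<rightarrow>\<^sub>E UNIV"
  by (simp add: bin_arm_def)

lemma measurable_bin_arm: "bin_arm \<in> measurable sample (count_space ({..<n} \<rightarrow>\<^sub>E UNIV))"
  using bin_arm_in_PiE atom_eq_bin_arm[symmetric]
  by (simp add: measurable_count_space_eq_countable[OF countable_bin_arm])

lemma in_own_atom:
  "\<omega> \<in> space sample \<Longrightarrow> \<omega> \<in> atom (fst \<circ> bin_arm \<omega>) (snd \<circ> bin_arm \<omega>)"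
  by (subst atom_eq_bin_arm[OF bin_arm_in_PiE]) simp

lemma measurable_miscov: "miscov n \<alpha> \<epsilon> p s \<in> borel_measurable sample"
proof -
  define m :: "(nat \<Rightarrow> int \<times> bool) \<Rightarrow> (nat \<Rightarrow> 'x \<times> 'y \<times> bool) \<Rightarrow> real"
    where "m v \<omega> = (if N0 n (snd \<circ> v) = 0 then 0 else
      (1 / N0 n (snd \<circ> v)) * (\<Sum>i\<in>{i\<in>{..<n}. \<not> (snd \<circ> v) i}.
        if masked_quantile (fst \<circ> v) (snd \<circ> v) \<omega> < score \<omega> i then 1 else 0))" for v \<omega>
  have m: "m v \<in> borel_measurable sample" for v
  proof (cases "N0 n (snd \<circ> v) = 0")
    case False
    note [measurable] = measurable_quantiles(2)[OF False]
    have "(\<lambda>\<omega>. \<Sum>i\<in>{i\<in>{..<n}. \<not> (snd \<circ> v) i}.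
      if masked_quantile (fst \<circ> v) (snd \<circ> v) \<omega> < score \<omega> i then 1 else (0::real))
      \<in> borel_measurable sample"
    proof (rule borel_measurable_sum)
      fix i assume "i \<in> {i\<in>{..<n}. \<not> (snd \<circ> v) i}"
      then have [measurable]: "i < n" by simp
      show "(\<lambda>\<omega>. if masked_quantile (fst \<circ> v) (snd \<circ> v) \<omega> < score \<omega> i then 1 else 0 :: real)
          \<in> borel_measurable sample"
        by measurable
    qed
    then show ?thesis using False by (simp add: m_def[abs_def])
  qed (simp add: m_def[abs_def])
  have "(\<lambda>\<omega>. m (bin_arm \<omega>) \<omega>) \<in> borel_measurable sample"
    by (rule measurable_compose_countable'[where f = m and g = bin_arm,
          OF m measurable_bin_arm countable_bin_arm])
  moreover have "miscov n \<alpha> \<epsilon> p s \<omega> = m (bin_arm \<omega>) \<omega>" if "\<omega> \<in> space sample" for \<omega>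
    unfolding m_def by (rule miscov_on_atom[OF in_own_atom[OF that]])
  ultimately show ?thesis by (simp only: cong: measurable_cong)
qed

lemma miscov_bounds: "0 \<le> miscov n \<alpha> \<epsilon> p s \<omega>" "miscov n \<alpha> \<epsilon> p s \<omega> \<le> 1"
proof -
  let ?I = "{i\<in>{..<n}. \<not> Avec \<omega> i}"
  let ?S = "\<Sum>i\<in>?I. if fst (snd (\<omega> i)) \<notin> Cpro2 n \<alpha> \<epsilon> p s \<omega> (fst (\<omega> i)) then 1 else (0::real)"
  have "0 \<le> ?S" by (rule sum_nonneg) simp
  moreover have "?S \<le> (\<Sum>i\<in>?I. 1)" by (rule sum_mono) simp
  then have "?S \<le> N0 n (Avec \<omega>)" by (simp add: N0_def)
  moreover have "0 \<le> N0 n (Avec \<omega>)" by (simp add: N0_def)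
  ultimately show "0 \<le> miscov n \<alpha> \<epsilon> p s \<omega>" "miscov n \<alpha> \<epsilon> p s \<omega> \<le> 1"
    by (auto simp: miscov_def divide_le_eq)
qed

lemma integrable_miscov_sq: "integrable sample (\<lambda>\<omega>. (miscov n \<alpha> \<epsilon> p s \<omega>)\<^sup>2)"
proof -
  interpret prob_space sample by (rule prob_space_sample)
  note [measurable] = measurable_miscov
  show ?thesis
    using miscov_bounds by (intro integrable_const_bound[where B = 1]) (auto simp: power_le_one)
qed

text \<open>Masking raises scores to \<open>\<infinity>\<close>, which lowers the cdf and raises the
  quantile. Miscoverage by the actual set therefore implies exceedance of the oracle
  quantile.\<close>

lemma masked_quantile_ge: "full_quantile b a \<omega> \<le> masked_quantile b a \<omega>"
  unfolding full_quantile_def masked_quantile_def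
  by (intro Qlevel_mono pro2_cdf_antimono) simp

text \<open>After passing to the oracle quantile, the square of the count of exceedances expands
  into a sum over ordered pairs of missing indices, diagonal included.\<close>

lemma miscov_sq_le_exceed:
  assumes "\<omega> \<in> atom b a" "N0 n a \<noteq> 0"
  shows "(miscov n \<alpha> \<epsilon> p s \<omega>)\<^sup>2 \<le> (\<Sum>z\<in>{i\<in>{..<n}. \<not> a i} \<times> {i\<in>{..<n}. \<not> a i}.
    indicator (exceed b a z) \<omega>) / (N0 n a)\<^sup>2"
proof -
  let ?I = "{i\<in>{..<n}. \<not> a i}"
  let ?d = "\<lambda>i. if full_quantile b a \<omega> < score \<omega> i then 1 else (0::real)"
  have "(\<Sum>i\<in>?I. if masked_quantile b a \<omega> < score \<omega> i then 1 else (0::real)) \<le> (\<Sum>i\<in>?I. ?d i)"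
    by (rule sum_mono) (auto dest: le_less_trans[OF masked_quantile_ge])
  then have "(\<Sum>i\<in>?I. if masked_quantile b a \<omega> < score \<omega> i then 1 else (0::real))\<^sup>2 \<le> (\<Sum>i\<in>?I. ?d i)\<^sup>2"
    by (rule power_mono) (simp add: sum_nonneg)
  also have "(\<Sum>i\<in>?I. ?d i)\<^sup>2 = (\<Sum>z\<in>?I \<times> ?I. indicator (exceed b a z) \<omega>)"
    unfolding power2_eq_square sum_product sum.cartesian_product
    by (rule sum.cong) (auto simp: exceed_def assms(1) indicator_def)
  finally show ?thesis
    unfolding miscov_on_atom[OF assms(1)]
    using assms(2) by (simp add: power_divide divide_right_mono)
qed

lemma exceed_sum_le:
  assumes "N0 n a \<noteq> 0"
  shows "(\<Sum>z\<in>{..<n} \<times> {..<n}. pro2_weight n b a z * indicator (exceed b a z) \<omega>)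
    \<le> \<alpha>\<^sup>2 * indicator (atom b a) \<omega>"
proof (cases "\<omega> \<in> atom b a")
  case True
  let ?q = "full_quantile b a \<omega>"
  have "indicator (exceed b a z) \<omega>
      = (if ?q < score \<omega> (fst z) \<and> ?q < score \<omega> (snd z) then 1 else (0::real))" for z
    using True by (simp add: exceed_def indicator_def)
  then show ?thesis
    using Qlevel_pro2_exceedance[OF level_le_1 assms, of b "\<lambda>i. ereal (score \<omega> i)"] True
    by (simp only: full_quantile_def[symmetric]) simp
qed (simp add: exceed_def)

text \<open>The unnormalised form of the conditional bound, meaningful also for null atoms. It
  combines the trivial bound by the probability of the atom with the exchange bound.\<close>

lemma integral_miscov_sq_atom_le:
  "(\<integral>\<omega>. indicator (atom b a) \<omega> * (miscov n \<alpha> \<epsilon> p s \<omega>)\<^sup>2 \<partial>sample)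
    \<le> (\<alpha>\<^sup>2 + 2 * \<epsilon>) * measure sample (atom b a)" (is "?L \<le> _")
proof -
  interpret prob_space sample by (rule prob_space_sample)
  note [measurable] = measurable_miscov
  have int: "integrable sample (\<lambda>\<omega>. indicator (atom b a) \<omega> * (miscov n \<alpha> \<epsilon> p s \<omega>)\<^sup>2)"
    using integrable_mult_indicator[OF atom_in_sets integrable_miscov_sq] by simp
  have indG: "integrable sample (\<lambda>\<omega>. indicator (atom b a) \<omega> :: real)"
    by (simp add: integrable_indicator_iff emeasure_eq_measure)
  have le_1: "?L \<le> prob (atom b a)"
  proof -
    have "?L \<le> (\<integral>\<omega>. indicator (atom b a) \<omega> \<partial>sample)"
      using miscov_bounds
      by (intro integral_mono[OF int indG]) (auto simp: indicator_def power_le_one)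
    then show ?thesis by simp
  qed
  have "?L \<le> (1 + \<epsilon>)\<^sup>2 * (\<alpha>\<^sup>2 * prob (atom b a))"
  proof (cases "N0 n a = 0")
    case True
    then have "?L = (\<integral>\<omega>. 0 \<partial>sample)"
      by (intro Bochner_Integration.integral_cong) (auto simp: indicator_def miscov_on_atom)
    then show ?thesis by simp
  next
    case False
    let ?I = "{i\<in>{..<n}. \<not> a i}" and ?P = "{..<n} \<times> {..<n}"
    have sets: "exceed b a z \<in> sets sample" if "z \<in> ?P" for z
      using that by (intro exceed_in_sets[OF False]) auto
    then have ind: "integrable sample (\<lambda>\<omega>. indicator (exceed b a z) \<omega> :: real)" if "z \<in> ?P" for z
      using that by (simp add: integrable_indicator_iff emeasure_eq_measure)
    have "?L \<le> (\<integral>\<omega>. (\<Sum>z\<in>?I \<times> ?I. indicator (exceed b a z) \<omega>) / (N0 n a)\<^sup>2 \<partial>sample)"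
      using miscov_sq_le_exceed[OF _ False]
      by (intro integral_mono[OF int] integrable_divide Bochner_Integration.integrable_sum ind)
        (auto simp: indicator_def[of "atom b a"] intro!: divide_nonneg_nonneg sum_nonneg)
    also have "\<dots> = (\<Sum>z\<in>?I \<times> ?I. prob (exceed b a z)) / (N0 n a)\<^sup>2"
      by (subst integral_divide_zero, subst Bochner_Integration.integral_sum)
        (auto intro!: ind sum.cong arg_cong2[of _ _ _ _ "(/)"] Bochner_Integration.integral_indicator
          simp: sets)
    \<comment> \<open>Each missing pair is compared with all pairs of its type; the resulting class
      shares, divided by \<open>(N0 n a)\<^sup>2\<close>, are exactly the weights of the
      procedure.\<close>
    also have "\<dots> \<le> ((1 + \<epsilon>)\<^sup>2 * (\<Sum>x\<in>?P. real (card {z\<in>?I \<times> ?I. pair_key b z = pair_key b x})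
        / real (card {z\<in>?P. pair_key b z = pair_key b x}) * prob (exceed b a x))) / (N0 n a)\<^sup>2"
      by (intro divide_right_mono sum_le_class_average)
        (auto intro: prob_exceed_pair_key_le[OF False])
    also have "\<dots> = (1 + \<epsilon>)\<^sup>2 * (\<Sum>z\<in>?P. pro2_weight n b a z * prob (exceed b a z))"
      unfolding pro2_weight_def times_divide_eq_right[symmetric] sum_divide_distrib by simp
    also have "(\<Sum>z\<in>?P. pro2_weight n b a z * prob (exceed b a z))
        = (\<integral>\<omega>. (\<Sum>z\<in>?P. pro2_weight n b a z * indicator (exceed b a z) \<omega>) \<partial>sample)"
      by (subst Bochner_Integration.integral_sum) (auto intro!: ind sum.cong simp: sets)
    also have "\<dots> \<le> (\<integral>\<omega>. \<alpha>\<^sup>2 * indicator (atom b a) \<omega> \<partial>sample)"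
      by (intro integral_mono Bochner_Integration.integrable_sum integrable_mult_right ind indG
          exceed_sum_le[OF False])
    also have "\<dots> = \<alpha>\<^sup>2 * prob (atom b a)" by simp
    finally show ?thesis by (simp add: mult_left_mono)
  qed
  then show ?thesis
    by (intro inflation_bound[OF alpha_pos alpha_less_1 eps_pos measure_nonneg le_1])
qed

section \<open>From atoms to the conditional expectation\<close>

lemma sets_BA_algebra:
  "A \<in> sets (BA_algebra n \<epsilon> p sample) \<longleftrightarrow> (\<exists>V. A = bin_arm -` V \<inter> space sample)"
  unfolding BA_algebra_def bin_arm_def[symmetric, abs_def] by (auto simp: sets_vimage_algebra2)

lemma subalgebra_BA_algebra: "subalgebra sample (BA_algebra n \<epsilon> p sample)"
  unfolding subalgebra_def
proof
  show "space (BA_algebra n \<epsilon> p sample) = space sample" by (simp add: BA_algebra_def)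
  show "sets (BA_algebra n \<epsilon> p sample) \<subseteq> sets sample"
  proof
    fix A assume "A \<in> sets (BA_algebra n \<epsilon> p sample)"
    then obtain V where "A = bin_arm -` V \<inter> space sample" by (auto simp: sets_BA_algebra)
    \<comment> \<open>Restricting \<open>V\<close> to the countable range makes its preimage
      measurable in the sample space.\<close>
    then have "A = bin_arm -` (V \<inter> ({..<n} \<rightarrow>\<^sub>E UNIV)) \<inter> space sample"
      using bin_arm_in_PiE by auto
    then show "A \<in> sets sample"
      using measurable_sets[OF measurable_bin_arm, of "V \<inter> ({..<n} \<rightarrow>\<^sub>E UNIV)"]
      by (simp del: vimage_Int)
  qed
qed

text \<open>It suffices to argue on each of countably many atoms. There the conditional expectation
  is either nowhere above the bound, or above it everywhere, in which case the integral bound forces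
  equality almost everywhere.\<close>

lemma cond_exp_miscov_sq_le:
  "AE \<omega> in sample. real_cond_exp sample (BA_algebra n \<epsilon> p sample)
    (\<lambda>\<omega>. (miscov n \<alpha> \<epsilon> p s \<omega>)\<^sup>2) \<omega> \<le> \<alpha>\<^sup>2 + 2 * \<epsilon>"
proof -
  interpret prob_space sample by (rule prob_space_sample)
  let ?F = "BA_algebra n \<epsilon> p sample" and ?f = "\<lambda>\<omega>. (miscov n \<alpha> \<epsilon> p s \<omega>)\<^sup>2"
  let ?c = "\<alpha>\<^sup>2 + 2 * \<epsilon>"
  interpret finite_measure_subalgebra sample ?F
    by unfold_locales (rule subalgebra_BA_algebra)
  let ?E = "real_cond_exp sample ?F ?f"
  have int_E: "integrable sample ?E" by (rule real_cond_exp_int(1)[OF integrable_miscov_sq])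
  have "AE \<omega> in sample. bin_arm \<omega> = v \<longrightarrow> ?E \<omega> \<le> ?c" if v: "v \<in> {..<n} \<rightarrow>\<^sub>E UNIV" for v
  proof -
    let ?G = "atom (fst \<circ> v) (snd \<circ> v)"
    have G: "?G = bin_arm -` {v} \<inter> space sample" by (rule atom_eq_bin_arm[OF v])
    \<comment> \<open>This event belongs to the conditioning algebra, so it is a preimage under
      \<open>bin_arm\<close> and contains either all of the atom or none of it.\<close>
    have "{\<omega>\<in>space ?F. ?E \<omega> > ?c} \<in> sets ?F" by measurable
    then obtain V where V: "{\<omega>\<in>space ?F. ?E \<omega> > ?c} = bin_arm -` V \<inter> space sample"
      by (auto simp: sets_BA_algebra)
    have sp: "space ?F = space sample" by (simp add: BA_algebra_def)
    show ?thesis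
    proof (cases "v \<in> V")
      case False
      show ?thesis
      proof (rule AE_I2, rule impI, rule ccontr)
        fix \<omega> assume "\<omega> \<in> space sample" "bin_arm \<omega> = v" "\<not> ?E \<omega> \<le> ?c"
        then have "\<omega> \<in> {\<omega>\<in>space ?F. ?E \<omega> > ?c}" by (simp add: sp)
        then show False using V False \<open>bin_arm \<omega> = v\<close> by auto
      qed
    next
      case True
      have gt: "?c < ?E \<omega>" if "\<omega> \<in> ?G" for \<omega>
      proof -
        have "\<omega> \<in> bin_arm -` V \<inter> space sample" using that True by (simp add: G)
        then show ?thesis using V by auto
      qed
      have "?G \<in> sets ?F" unfolding sets_BA_algebra using G by blast
      from real_cond_exp_intA[OF integrable_miscov_sq this]
      have "(\<integral>\<omega>. indicator ?G \<omega> * ?E \<omega> \<partial>sample) \<le> ?c * prob ?G"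
        using integral_miscov_sq_atom_le[of "fst \<circ> v" "snd \<circ> v"]
        by (simp add: set_lebesgue_integral_def)
      moreover have iE: "integrable sample (\<lambda>\<omega>. indicator ?G \<omega> * ?E \<omega>)"
        using integrable_mult_indicator[OF atom_in_sets int_E] by simp
      moreover have iG: "integrable sample (\<lambda>\<omega>. indicator ?G \<omega> * ?c)"
        by (simp add: integrable_indicator_iff emeasure_eq_measure)
      ultimately have "(\<integral>\<omega>. indicator ?G \<omega> * ?E \<omega> - indicator ?G \<omega> * ?c \<partial>sample) \<le> 0"
        by (subst Bochner_Integration.integral_diff) (auto simp: mult.commute)
      moreover have nonneg: "0 \<le> indicator ?G \<omega> * ?E \<omega> - indicator ?G \<omega> * ?c" for \<omega>
        using gt[of \<omega>] by (auto simp: indicator_def)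
      \<comment> \<open>A nonnegative function with integral at most zero vanishes almost
        everywhere.\<close>
      ultimately have "(\<integral>\<omega>. indicator ?G \<omega> * ?E \<omega> - indicator ?G \<omega> * ?c \<partial>sample) = 0"
        by (intro antisym Bochner_Integration.integral_nonneg)
      then have "AE \<omega> in sample. indicator ?G \<omega> * ?E \<omega> - indicator ?G \<omega> * ?c = 0"
        using integral_nonneg_eq_0_iff_AE[OF Bochner_Integration.integrable_diff[OF iE iG]] nonneg
        by simp
      then show ?thesis
        by (rule AE_mp) (auto intro!: AE_I2 simp: G indicator_def)
    qed
  qed
  then have "AE \<omega> in sample. \<forall>v\<in>{..<n} \<rightarrow>\<^sub>E UNIV. bin_arm \<omega> = v \<longrightarrow> ?E \<omega> \<le> ?c"
    by (subst AE_ball_countable[OF countable_bin_arm]) blast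
  then show ?thesis using bin_arm_in_PiE by (auto elim: AE_mp)
qed

end

theorem theorem5:
  fixes PX :: "'x measure" and MY :: "'y measure" and K :: "'x \<Rightarrow> 'y measure"
    and p :: "'x \<Rightarrow> real" and s :: "'x \<Rightarrow> 'y \<Rightarrow> real"
    and n :: nat and \<alpha> \<epsilon> :: real
  assumes "prob_space PX"
    and "K \<in> measurable PX (prob_algebra MY)"
    and "p \<in> borel_measurable PX"
    and "\<And>x. x \<in> space PX \<Longrightarrow> 0 < p x \<and> p x < 1"
    and "(\<lambda>(x, y). s x y) \<in> borel_measurable (PX \<Otimes>\<^sub>M MY)"
    and "0 < \<epsilon>"
    and "0 < \<alpha>" and "\<alpha> < 1"
  shows "AE \<omega> in PiM {..<n} (\<lambda>_. obs_law PX MY K p).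
           real_cond_exp (PiM {..<n} (\<lambda>_. obs_law PX MY K p))
             (BA_algebra n \<epsilon> p (PiM {..<n} (\<lambda>_. obs_law PX MY K p)))
             (\<lambda>\<omega>. (miscov n \<alpha> \<epsilon> p s \<omega>)\<^sup>2) \<omega>
           \<le> \<alpha>\<^sup>2 + 2 * \<epsilon>"
proof -
  interpret mar_score PX MY K p s n \<alpha> \<epsilon>
    by (intro mar_score.intro mar_model.intro mar_score_axioms.intro; fact assms)
  show ?thesis by (rule cond_exp_miscov_sq_le)
qed

end
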